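(* ($G$-invariant definable Tietze extension theorem.) Let $\mathcal F=(F,<,+,\cdot,0,1,\ldots)$ be a definably complete expansion of an ordered field. Let $G\subseteq F^m$ be a definably compact definable topological group and let $X\subseteq F^n$ be a definable $G$-set which is locally closed in $F^n$. Let $A\subseteq X$ be a definable $G$-invariant subset which is closed in $X$, and let $\varphi:A\to F$ be a $G$-invariant definable continuous function. Then there exists a $G$-invariant definable continuous function $\Phi:X\to F$ with $\Phi|_A=\varphi$.
   Context: All topologies are the order topology on $F$ and the product topology on $F^k$. "Definable" means definable in $\mathcal F$ with parameters. $\mathcal F$ is definably complete if every definable subset of $F$ has a supremum and an infimum in $F\cup\{\pm\infty\}$. A definable topological group is a group $(G,\cdot)$ whose underlying set is a definable subset of some $F^m$ and whose multiplication and inverse maps are definable and continuous. A definable set is definably compact if it is closed and bounded in its ambient space $F^m$. A definable $G$-set is a definable set $X\subseteq F^n$ on which $G$ acts via a definable continuous map $G\times X\to X$, $(g,x)\mapsto gx$. A subset $A\subseteq X$ is $G$-invariant if $gA\subseteq A$ for all $g\in G$; a function $f$ on a $G$-invariant set is $G$-invariant if $f(gx)=f(x)$ for all $g\in G$ and $x$ in its domain. *)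

theory Defs
  imports Main
begin

definition fsp :: "nat \<Rightarrow> 'a list set" where
  "fsp n = {xs. length xs = n}"

text \<open>Basic open boxes; they form a neighbourhood base of the product of the order topologies.\<close>
definition box :: "nat \<Rightarrow> 'a::linordered_field list \<Rightarrow> 'a \<Rightarrow> 'a list set" where
  "box n x e = {y \<in> fsp n. \<forall>i<n. \<bar>y ! i - x ! i\<bar> < e}"

definition openF :: "nat \<Rightarrow> 'a::linordered_field list set \<Rightarrow> bool" where
  "openF n U \<longleftrightarrow> U \<subseteq> fsp n \<and> (\<forall>x\<in>U. \<exists>e>0. box n x e \<subseteq> U)"

definition closedF :: "nat \<Rightarrow> 'a::linordered_field list set \<Rightarrow> bool" where
  "closedF n C \<longleftrightarrow> C \<subseteq> fsp n \<and> openF n (fsp n - C)"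

definition closed_inF :: "nat \<Rightarrow> 'a::linordered_field list set \<Rightarrow> 'a list set \<Rightarrow> bool" where
  "closed_inF n A X \<longleftrightarrow> A \<subseteq> X \<and> (\<forall>x\<in>X - A. \<exists>e>0. box n x e \<inter> A = {})"

definition locally_closedF :: "nat \<Rightarrow> 'a::linordered_field list set \<Rightarrow> bool" where
  "locally_closedF n X \<longleftrightarrow> (\<exists>U C. openF n U \<and> closedF n C \<and> X = U \<inter> C)"

definition boundedF :: "nat \<Rightarrow> 'a::linordered_field list set \<Rightarrow> bool" where
  "boundedF n S \<longleftrightarrow> (\<exists>R. \<forall>x\<in>S. \<forall>i<n. \<bar>x ! i\<bar> \<le> R)"

definition contF :: "nat \<Rightarrow> nat \<Rightarrow> 'a::linordered_field list set \<Rightarrow> ('a list \<Rightarrow> 'a list) \<Rightarrow> bool" where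
  "contF k l S f \<longleftrightarrow> (\<forall>x\<in>S. f x \<in> fsp l) \<and>
     (\<forall>x\<in>S. \<forall>e>0. \<exists>d>0. \<forall>y\<in>S \<inter> box k x d. f y \<in> box l (f x) e)"

text \<open>D n = the definable (with parameters) subsets of F^n of an expansion of the ordered
  field 'a; axiomatised as a "structure" in the sense of van den Dries.\<close>
definition expansion_structure :: "(nat \<Rightarrow> 'a::linordered_field list set set) \<Rightarrow> bool" where
  "expansion_structure D \<longleftrightarrow>
     (\<forall>n. \<forall>A\<in>D n. A \<subseteq> fsp n) \<and>
     (\<forall>n. {} \<in> D n) \<and>
     (\<forall>n. \<forall>A\<in>D n. \<forall>B\<in>D n. A \<union> B \<in> D n) \<and>
     (\<forall>n. \<forall>A\<in>D n. fsp n - A \<in> D n) \<and>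
     (\<forall>n. \<forall>A\<in>D n. {x @ [c] | x c. x \<in> A} \<in> D (Suc n) \<and> {c # x | c x. x \<in> A} \<in> D (Suc n)) \<and>
     (\<forall>n i j. i < n \<and> j < n \<longrightarrow> {x \<in> fsp n. x ! i = x ! j} \<in> D n) \<and>
     (\<forall>n. \<forall>A\<in>D (Suc n). butlast ` A \<in> D n) \<and>
     {[x, y] | x y. x < y} \<in> D 2 \<and>
     {[x, y, x + y] | x y. True} \<in> D 3 \<and>
     {[x, y, x * y] | x y. True} \<in> D 3 \<and>
     (\<forall>c. {[c]} \<in> D 1)"

definition definably_complete :: "(nat \<Rightarrow> 'a::linordered_field list set set) \<Rightarrow> bool" where
  "definably_complete D \<longleftrightarrow>
     (\<forall>S. {[s] | s. s \<in> S} \<in> D 1 \<longrightarrow>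
        ((S \<noteq> {} \<and> (\<exists>b. \<forall>x\<in>S. x \<le> b)) \<longrightarrow> (\<exists>s. (\<forall>x\<in>S. x \<le> s) \<and> (\<forall>b. (\<forall>x\<in>S. x \<le> b) \<longrightarrow> s \<le> b))) \<and>
        ((S \<noteq> {} \<and> (\<exists>b. \<forall>x\<in>S. b \<le> x)) \<longrightarrow> (\<exists>s. (\<forall>x\<in>S. s \<le> x) \<and> (\<forall>b. (\<forall>x\<in>S. b \<le> x) \<longrightarrow> b \<le> s))))"

definition def_fun :: "(nat \<Rightarrow> 'a list set set) \<Rightarrow> nat \<Rightarrow> nat \<Rightarrow> 'a list set \<Rightarrow> ('a list \<Rightarrow> 'a list) \<Rightarrow> bool" where
  "def_fun D k l S f \<longleftrightarrow> {x @ f x | x. x \<in> S} \<in> D (k + l)"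

definition def_top_group :: "(nat \<Rightarrow> 'a::linordered_field list set set) \<Rightarrow> nat \<Rightarrow> 'a list set
    \<Rightarrow> ('a list \<Rightarrow> 'a list \<Rightarrow> 'a list) \<Rightarrow> ('a list \<Rightarrow> 'a list) \<Rightarrow> bool" where
  "def_top_group D m G mult ginv \<longleftrightarrow>
     G \<in> D m \<and>
     (\<forall>g\<in>G. \<forall>h\<in>G. mult g h \<in> G) \<and>
     (\<forall>g\<in>G. \<forall>h\<in>G. \<forall>k\<in>G. mult (mult g h) k = mult g (mult h k)) \<and>
     (\<exists>e\<in>G. (\<forall>g\<in>G. mult e g = g \<and> mult g e = g) \<and>
        (\<forall>g\<in>G. ginv g \<in> G \<and> mult (ginv g) g = e \<and> mult g (ginv g) = e)) \<and>
     def_fun D (m + m) m {g @ h | g h. g \<in> G \<and> h \<in> G} (\<lambda>z. mult (take m z) (drop m z)) \<and>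
     contF (m + m) m {g @ h | g h. g \<in> G \<and> h \<in> G} (\<lambda>z. mult (take m z) (drop m z)) \<and>
     def_fun D m m G ginv \<and>
     contF m m G ginv"

definition definably_compact :: "(nat \<Rightarrow> 'a::linordered_field list set set) \<Rightarrow> nat \<Rightarrow> 'a list set \<Rightarrow> bool" where
  "definably_compact D n S \<longleftrightarrow> S \<in> D n \<and> closedF n S \<and> boundedF n S"

definition def_G_set :: "(nat \<Rightarrow> 'a::linordered_field list set set) \<Rightarrow> nat \<Rightarrow> 'a list set
    \<Rightarrow> ('a list \<Rightarrow> 'a list \<Rightarrow> 'a list) \<Rightarrow> nat \<Rightarrow> 'a list set \<Rightarrow> ('a list \<Rightarrow> 'a list \<Rightarrow> 'a list) \<Rightarrow> bool" where
  "def_G_set D m G mult n X act \<longleftrightarrow>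
     X \<in> D n \<and>
     (\<forall>g\<in>G. \<forall>x\<in>X. act g x \<in> X) \<and>
     (\<forall>e\<in>G. (\<forall>g\<in>G. mult e g = g \<and> mult g e = g) \<longrightarrow> (\<forall>x\<in>X. act e x = x)) \<and>
     (\<forall>g\<in>G. \<forall>h\<in>G. \<forall>x\<in>X. act (mult g h) x = act g (act h x)) \<and>
     def_fun D (m + n) n {g @ x | g x. g \<in> G \<and> x \<in> X} (\<lambda>z. act (take m z) (drop m z)) \<and>
     contF (m + n) n {g @ x | g x. g \<in> G \<and> x \<in> X} (\<lambda>z. act (take m z) (drop m z))"

definition G_invariant_set :: "'a list set \<Rightarrow> ('a list \<Rightarrow> 'a list \<Rightarrow> 'a list) \<Rightarrow> 'a list set \<Rightarrow> bool" where
  "G_invariant_set G act A \<longleftrightarrow> (\<forall>g\<in>G. \<forall>x\<in>A. act g x \<in> A)"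

definition G_invariant_fun :: "'a list set \<Rightarrow> ('a list \<Rightarrow> 'a list \<Rightarrow> 'a list) \<Rightarrow> 'a list set \<Rightarrow> ('a list \<Rightarrow> 'b) \<Rightarrow> bool" where
  "G_invariant_fun G act A f \<longleftrightarrow> (\<forall>g\<in>G. \<forall>x\<in>A. f (act g x) = f x)"

end

theory Submission
  imports Defs
begin

text \<open>Non-equivariantly, a definable continuous \<open>\<psi> \<ge> 1\<close> on \<open>A\<close> is extended off \<open>A\<close> by
  \<open>inf\<^sub>a \<psi>(a) d(x, a) / d(x, A)\<close>, with \<open>d\<close> the sup-distance; the infima exist by definable
  completeness. Writing \<open>\<phi>\<close> as the difference of its positive and negative parts, each shifted by
  \<open>1\<close>, gives a continuous extension \<open>\<Phi>\<^sub>0\<close> of an arbitrary \<open>\<phi>\<close>. The minimum of \<open>\<Phi>\<^sub>0(g x)\<close>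
  over \<open>g \<in> G\<close> is \<open>G\<close>-invariant, and still equals \<open>\<phi>\<close> on \<open>A\<close>. It is continuous because
  definable compactness of \<open>G\<close> makes the continuity of \<open>x \<mapsto> \<Phi>\<^sub>0(g x)\<close> at a point uniform in \<open>g\<close>.\<close>

section \<open>Distances and infima\<close>

lemma length_fsp [simp]: "x \<in> fsp n \<longleftrightarrow> length x = n"
  by (simp add: fsp_def)

definition is_glb :: "'a::linorder set \<Rightarrow> 'a \<Rightarrow> bool" where
  "is_glb S s \<longleftrightarrow> (\<forall>x\<in>S. s \<le> x) \<and> (\<forall>b. (\<forall>x\<in>S. b \<le> x) \<longrightarrow> b \<le> s)"

text \<open>The value 0 in the absence of a greatest lower bound makes this a total function, so
  \<open>dft_infF\<close> can establish definability without first proving that the infimum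
  exists.\<close>

definition infF :: "'a::{linorder,zero} set \<Rightarrow> 'a" where
  "infF S = (if \<exists>s. is_glb S s then THE s. is_glb S s else 0)"

lemma is_glb_infF: "is_glb S s \<Longrightarrow> infF S = s"
proof -
  assume S: "is_glb S s"
  then have "(THE s. is_glb S s) = s"
    by (intro the_equality) (auto simp: is_glb_def intro: order.antisym)
  then show ?thesis using S by (auto simp: infF_def)
qed

lemma is_glb_lower: "is_glb S s \<Longrightarrow> x \<in> S \<Longrightarrow> s \<le> x"
  and is_glb_greatest: "is_glb S s \<Longrightarrow> (\<And>x. x \<in> S \<Longrightarrow> b \<le> x) \<Longrightarrow> b \<le> s"
  by (auto simp: is_glb_def)

text \<open>Only the first \<open>n\<close> coordinates enter, and the lists may be longer. This
  allows \<open>definable_cluster_point\<close> to compare whole points with an initial segment of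
  their limit.\<close>

primrec sdist :: "nat \<Rightarrow> 'a::linordered_field list \<Rightarrow> 'a list \<Rightarrow> 'a" where
  "sdist 0 x y = 0"
| "sdist (Suc n) x y = max (sdist n x y) \<bar>x ! n - y ! n\<bar>"

lemma sdist_nonneg: "0 \<le> sdist n x y"
  by (induction n) (auto simp: max_def)

lemma sdist_le_iff: "0 \<le> e \<Longrightarrow> sdist n x y \<le> e \<longleftrightarrow> (\<forall>i<n. \<bar>x ! i - y ! i\<bar> \<le> e)"
  by (induction n) (auto simp: less_Suc_eq)

lemma sdist_less_iff: "0 < e \<Longrightarrow> sdist n x y < e \<longleftrightarrow> (\<forall>i<n. \<bar>x ! i - y ! i\<bar> < e)"
  by (induction n) (auto simp: less_Suc_eq)

lemma sdist_commute: "sdist n x y = sdist n y x"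
  by (induction n) (auto simp: abs_minus_commute)

lemma sdist_triangle: "sdist n x z \<le> sdist n x y + sdist n y z"
proof -
  have "\<bar>x ! i - z ! i\<bar> \<le> sdist n x y + sdist n y z" if "i < n" for i
  proof -
    have "\<bar>x ! i - z ! i\<bar> \<le> \<bar>x ! i - y ! i\<bar> + \<bar>y ! i - z ! i\<bar>"
      using abs_triangle_ineq[of "x ! i - y ! i" "y ! i - z ! i"] by simp
    also have "\<dots> \<le> sdist n x y + sdist n y z"
      using sdist_le_iff[OF sdist_nonneg, of n x y n x y] sdist_le_iff[OF sdist_nonneg, of n y z n y z] that
      by (intro add_mono) auto
    finally show ?thesis .
  qed
  then show ?thesis by (simp add: sdist_le_iff sdist_nonneg)
qed

lemma sdist_append: "n \<le> length y \<Longrightarrow> sdist n x (y @ z) = sdist n x y"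
  by (induction n) (auto simp: nth_append)

lemma box_iff: "0 < e \<Longrightarrow> y \<in> box n x e \<longleftrightarrow> length y = n \<and> sdist n x y < e"
  by (subst sdist_commute) (simp add: box_def sdist_less_iff)

definition scont :: "nat \<Rightarrow> 'a::linordered_field list set \<Rightarrow> ('a list \<Rightarrow> 'a) \<Rightarrow> bool" where
  "scont n X f \<longleftrightarrow> (\<forall>x\<in>X. \<forall>e>0. \<exists>r>0. \<forall>y\<in>X. sdist n x y < r \<longrightarrow> \<bar>f y - f x\<bar> < e)"

lemma contF_scont:
  assumes "X \<subseteq> fsp n"
  shows "contF n 1 X (\<lambda>x. [f x]) \<longleftrightarrow> scont n X f"
proof -
  have "[f y] \<in> box 1 [f x] e \<longleftrightarrow> \<bar>f y - f x\<bar> < e" for x y e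
    by (simp add: box_def)
  then have "(\<forall>y\<in>X \<inter> box n x d. [f y] \<in> box 1 [f x] e) \<longleftrightarrow> (\<forall>y\<in>X. sdist n x y < d \<longrightarrow> \<bar>f y - f x\<bar> < e)"
    if "0 < d" for x d e
    using assms that by (auto simp: box_iff)
  then show ?thesis unfolding contF_def scont_def by (auto simp: cong: conj_cong)
qed

lemma scont_diff:
  assumes "scont n X f" "scont n X g"
  shows "scont n X (\<lambda>x. f x - g x)"
  unfolding scont_def
proof (intro ballI allI impI)
  fix x and e :: 'a assume "x \<in> X" "0 < e"
  then have "0 < e / 2" by simp
  then obtain r s where "0 < r" "\<forall>y\<in>X. sdist n x y < r \<longrightarrow> \<bar>f y - f x\<bar> < e / 2"
    "0 < s" "\<forall>y\<in>X. sdist n x y < s \<longrightarrow> \<bar>g y - g x\<bar> < e / 2"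
    using assms \<open>x \<in> X\<close> unfolding scont_def by metis
  moreover have "\<bar>(a - b) - (c - d)\<bar> < e" if "\<bar>a - c\<bar> < e / 2" "\<bar>b - d\<bar> < e / 2" for a b c d :: 'a
    using that unfolding abs_less_iff by (auto simp: field_simps) 
  ultimately show "\<exists>r>0. \<forall>y\<in>X. sdist n x y < r \<longrightarrow> \<bar>f y - g y - (f x - g x)\<bar> < e"
    by (intro exI[of _ "min r s"]) auto
qed

lemma scont_pos_part:
  assumes "scont n X f"
  shows "scont n X (\<lambda>x. max (f x) 0 + 1)"
proof -
  have "\<bar>(max a 0 + 1) - (max b 0 + 1)\<bar> \<le> \<bar>a - b\<bar>" for a b :: 'a
    by (auto simp: max_def abs_if)
  then show ?thesis using assms unfolding scont_def by (meson le_less_trans)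
qed

text \<open>Hausdorff's formula for extending a function that is bounded below by \<open>1\<close>.\<close>

lemma hausdorff_formula_continuous:
  fixes d :: "'b \<Rightarrow> 'b \<Rightarrow> 'a::linordered_field"
  assumes sym: "\<And>x y. d x y = d y x"
    and tri: "\<And>x y z. d x z \<le> d x y + d y z"
    and nonneg: "\<And>x y. 0 \<le> d x y"
    and ge1: "\<And>a. a \<in> A \<Longrightarrow> 1 \<le> \<psi> a"
    and cont: "\<And>a e. a \<in> A \<Longrightarrow> 0 < e \<Longrightarrow> \<exists>r>0. \<forall>b\<in>A. d a b < r \<longrightarrow> \<bar>\<psi> b - \<psi> a\<bar> < e"
    and J: "\<And>x. x \<in> X - A \<Longrightarrow> is_glb {\<psi> a * d x a | a. a \<in> A} (J x)"
    and \<delta>: "\<And>x. x \<in> X - A \<Longrightarrow> is_glb {d x a | a. a \<in> A} (\<delta> x)"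
    and pos: "\<And>x. x \<in> X - A \<Longrightarrow> 0 < \<delta> x"
    and x: "x \<in> X" and e: "0 < e"
  shows "\<exists>r>0. \<forall>y\<in>X. d x y < r \<longrightarrow>
    \<bar>(if y \<in> A then \<psi> y else J y / \<delta> y) - (if x \<in> A then \<psi> x else J x / \<delta> x)\<bar> < e"
proof (cases "x \<in> A")
  case False
  have J_le: "J y \<le> \<psi> a * d y a" if "y \<in> X - A" "a \<in> A" for y a
    using is_glb_lower[OF J] that by blast
  have \<delta>_le: "\<delta> y \<le> d y a" if "y \<in> X - A" "a \<in> A" for y a
    using is_glb_lower[OF \<delta>] that by blast
  have \<delta>_lip: "\<delta> z \<le> \<delta> y + d y z" if "y \<in> X - A" "z \<in> X - A" for y z
  proof -
    have "\<delta> z - d y z \<le> \<delta> y"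
    proof (rule is_glb_greatest[OF \<delta>[OF that(1)]])
      fix v assume "v \<in> {d y a | a. a \<in> A}"
      then obtain a where "a \<in> A" "v = d y a" by auto
      then show "\<delta> z - d y z \<le> v" using \<delta>_le[OF that(2), of a] tri[of z a y] sym[of y z] by simp
    qed
    then show ?thesis by simp
  qed
  \<comment> \<open>Since \<open>\<psi>\<close> need not be bounded above, \<open>J\<close> is
    compared by ratios. For each \<open>a\<close>, d(z,a) <= d(y,a) + d(y,z) <= d(y,a) (1 + d(y,z) /
    \<open>\<delta> y\<close>), because \<open>\<delta> y\<close> is at most d(y,a); the factor does
    not depend on \<open>a\<close>.\<close>
  have key: "J z * \<delta> y \<le> J y * (\<delta> y + d y z)" if yz: "y \<in> X - A" "z \<in> X - A" for y z
  proof -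
    let ?s = "\<delta> y + d y z"
    have s: "0 < ?s" using pos[OF yz(1)] nonneg[of y z] by simp
    have "J z * \<delta> y / ?s \<le> J y"
    proof (rule is_glb_greatest[OF J[OF yz(1)]])
      fix v assume "v \<in> {\<psi> a * d y a | a. a \<in> A}"
      then obtain a where a: "a \<in> A" and v: "v = \<psi> a * d y a" by auto
      have \<psi>: "0 \<le> \<psi> a" using ge1[OF a] by (rule order.trans[OF zero_le_one])
      have "J z * \<delta> y \<le> \<psi> a * d z a * \<delta> y"
        using J_le[OF yz(2) a] pos[OF yz(1)] by (intro mult_right_mono) auto
      also have "\<dots> \<le> \<psi> a * (d y a + d y z) * \<delta> y"
        using tri[of z a y] sym[of y z] pos[OF yz(1)] \<psi>
        by (intro mult_right_mono mult_left_mono) auto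
      also have "\<dots> = \<psi> a * (d y a * \<delta> y + d y z * \<delta> y)" by (simp add: algebra_simps)
      also have "\<dots> \<le> \<psi> a * (d y a * \<delta> y + d y z * d y a)"
        using \<delta>_le[OF yz(1) a] nonneg[of y z] \<psi> by (intro mult_left_mono add_left_mono) auto
      also have "\<dots> = v * ?s" by (simp add: v algebra_simps)
      finally show "J z * \<delta> y / ?s \<le> v" using s by (simp add: pos_divide_le_eq)
    qed
    then show ?thesis using s by (simp add: pos_divide_le_eq)
  qed
  have xX: "x \<in> X - A" using x False by simp
  define q K where "q = \<delta> x" and "K = J x / \<delta> x"
  have q: "0 < q" using pos[OF xX] by (simp add: q_def)
  have Kq: "J x = K * q" using q by (simp add: K_def q_def)
  have J0: "0 \<le> J y" if "y \<in> X - A" for y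
    using nonneg ge1 by (intro is_glb_greatest[OF J[OF that]]) (fastforce intro!: mult_nonneg_nonneg elim: order.trans[OF zero_le_one])
  have K: "0 \<le> K" using J0[OF xX] q by (simp add: K_def q_def)
  \<comment> \<open>Points of \<open>A\<close> have distance at least \<open>q\<close> from
    \<open>x\<close>, so \<open>q / 2\<close> keeps \<open>y\<close> outside \<open>A\<close>; it
    also makes q - 2 p positive for p = d(x,y). The other bound yields 4 p K < e q; its summand 1
    keeps the denominator positive when \<open>K\<close> is 0.\<close>
  let ?r = "min (q / 2) (e * q / (4 * K + 1))"
  have r: "0 < ?r" using q e K by (auto intro!: divide_pos_pos mult_pos_pos add_nonneg_pos)
  show ?thesis
  proof (intro exI[of _ ?r] conjI r ballI impI)
    fix y assume y: "y \<in> X" "d x y < ?r"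
    let ?p = "d x y"
    have p: "0 \<le> ?p" "2 * ?p < q" "?p * (4 * K + 1) < e * q"
      using y(2) nonneg[of x y] K by (auto simp: pos_less_divide_eq add_nonneg_pos)
    have "y \<notin> A" using \<delta>_le[OF xX, of y] p q_def by auto
    then have yX: "y \<in> X - A" using y by simp
    define Y where "Y = J y / \<delta> y"
    have \<delta>y: "0 < \<delta> y" using pos[OF yX] .
    have YJ: "J y = Y * \<delta> y" using \<delta>y by (simp add: Y_def)
    have Y0: "0 \<le> Y" using J0[OF yX] \<delta>y by (simp add: Y_def)
    have lip: "q \<le> \<delta> y + ?p" "\<delta> y \<le> q + ?p"
      using \<delta>_lip[OF yX xX] \<delta>_lip[OF xX yX] sym[of x y] by (auto simp: q_def)
    have "Y * \<delta> y * q \<le> K * (q + ?p) * q"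
      using key[OF xX yX] by (simp add: YJ Kq q_def[symmetric] mult_ac)
    then have "Y * \<delta> y \<le> K * (q + ?p)" using q by (simp only: mult_le_cancel_right_pos)
    moreover have "Y * (q - ?p) \<le> Y * \<delta> y" using lip Y0 by (intro mult_left_mono) auto
    ultimately have "Y * (q - ?p) * q \<le> K * (q + ?p) * q"
      using q by (intro mult_right_mono) auto
    \<comment> \<open>With denominators cleared, this is (q + p) / (q - p) <= 1 + 4 p / q, which
      holds for 2 p <= q.\<close>
    also have "\<dots> \<le> K * ((q + 4 * ?p) * (q - ?p))"
    proof -
      have "(q + 4 * ?p) * (q - ?p) - (q + ?p) * q = 2 * ?p * (q - 2 * ?p)" by (simp add: algebra_simps)
      moreover have "0 \<le> 2 * ?p * (q - 2 * ?p)" using p by (intro mult_nonneg_nonneg) auto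
      ultimately have "(q + ?p) * q \<le> (q + 4 * ?p) * (q - ?p)" by simp
      from mult_left_mono[OF this K] show ?thesis by (simp only: mult.assoc)
    qed
    finally have "(Y * q) * (q - ?p) \<le> (K * (q + 4 * ?p)) * (q - ?p)" by (simp only: mult_ac)
    then have upper: "Y * q \<le> K * (q + 4 * ?p)" using p by (simp only: mult_le_cancel_right)
    have "K * q * \<delta> y \<le> Y * (\<delta> y + ?p) * \<delta> y"
      using key[OF yX xX] by (simp add: YJ Kq sym[of y x] mult_ac)
    then have "K * q \<le> Y * (\<delta> y + ?p)" using \<delta>y by (simp only: mult_le_cancel_right_pos)
    also have "\<dots> \<le> Y * (q + 2 * ?p)" using lip Y0 by (intro mult_left_mono) auto
    finally have lower: "K * q \<le> Y * q + 2 * (?p * Y)" by (simp add: algebra_simps)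
    have pK: "4 * (?p * K) < e * q" using p by (simp add: algebra_simps)
    have "Y * q - K * q < e * q" using upper pK by (simp add: algebra_simps)
    then have 1: "Y - K < e" using q by (simp add: left_diff_distrib[symmetric])
    \<comment> \<open>The error term in \<open>lower\<close> contains \<open>Y\<close>. It is
      bounded by the same term with \<open>K\<close> if \<open>Y \<le> K\<close>; otherwise there is
      nothing to prove.\<close>
    have "K - Y < e"
    proof (cases "Y \<le> K")
      case True
      then have "?p * Y \<le> ?p * K" using p by (intro mult_left_mono) auto
      then have "K * q - Y * q < e * q" using lower pK mult_nonneg_nonneg[OF p(1) K] by linarith
      then show ?thesis using q by (simp add: left_diff_distrib[symmetric])
    qed (use e in auto)
    with 1 show "\<bar>(if y \<in> A then \<psi> y else J y / \<delta> y) - (if x \<in> A then \<psi> x else J x / \<delta> x)\<bar> < e"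
      using \<open>y \<notin> A\<close> False by (simp add: abs_less_iff Y_def K_def)
  qed
next
  case True
  define k where "k = \<psi> x"
  have k: "1 \<le> k" using ge1[OF True] by (simp add: k_def)
  obtain r where r: "0 < r" "\<And>b. b \<in> A \<Longrightarrow> d x b < r \<Longrightarrow> \<bar>\<psi> b - k\<bar> < e / 2"
    using cont[OF True, of "e / 2"] e unfolding k_def by auto
  \<comment> \<open>Chosen so that (k + e/2)(1 + \<open>\<theta>\<close>) = k + 3e/4. A point of
    \<open>A\<close> whose distance from \<open>y\<close> is below (1 + \<open>\<theta>\<close>)
    \<open>\<delta> y\<close> then gives a sufficient upper bound for
    \<open>J y / \<delta> y\<close>.\<close>
  define \<theta> where "\<theta> = e / 4 / (k + e / 2)"
  have ke: "0 < k + e / 2" using k e by (intro add_pos_pos) auto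
  have "c * (e / 4 / c) = e / 4" if "0 < c" for c using that by simp
  from this[OF ke] have \<theta>: "0 < \<theta>" "(k + e / 2) * \<theta> = e / 4"
    using ke e by (auto simp only: \<theta>_def intro!: divide_pos_pos)
  \<comment> \<open>The first bound puts such a nearly closest point within \<open>r\<close> of
    \<open>x\<close>, as \<open>\<eta>\<close> + (1 + \<open>\<theta>\<close>) \<open>\<eta>\<close>
    <= r. The second gives k \<open>\<eta>\<close> <= r - \<open>\<eta>\<close>, which deals with
    the points of \<open>A\<close> far from \<open>x\<close>.\<close>
  define \<eta> where "\<eta> = min (r / (2 + \<theta>)) (r / (k + 1))"
  have \<eta>0: "0 < \<eta>" using r(1) \<theta>(1) k by (auto simp: \<eta>_def intro!: divide_pos_pos add_pos_pos)
  have "\<eta> \<le> r / (2 + \<theta>)" "\<eta> \<le> r / (k + 1)" by (auto simp: \<eta>_def)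
  then have \<eta>: "\<eta> * (2 + \<theta>) \<le> r" "\<eta> * (k + 1) \<le> r"
    using \<theta>(1) k by (auto simp: pos_le_divide_eq add_pos_pos)
  have \<eta>r: "\<eta> < r" using \<eta>(2)[unfolded distrib_left] \<eta>0 mult_left_mono[OF k less_imp_le[OF \<eta>0]] by linarith
  show ?thesis
  proof (intro exI[of _ \<eta>] conjI \<eta>0 ballI impI)
    fix y assume y: "y \<in> X" "d x y < \<eta>"
    show "\<bar>(if y \<in> A then \<psi> y else J y / \<delta> y) - (if x \<in> A then \<psi> x else J x / \<delta> x)\<bar> < e"
    proof (cases "y \<in> A")
      case yA: True
      then have "\<bar>\<psi> y - k\<bar> < e / 2" using r(2) y(2) \<eta>r by auto
      also have "\<dots> \<le> e" using e by simp
      finally show ?thesis using True yA by (simp add: k_def)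
    next
      case yA: False
      then have yX: "y \<in> X - A" using y by simp
      have q0: "0 < \<delta> y" using pos[OF yX] .
      have \<delta>_le: "\<delta> y \<le> d y a" if "a \<in> A" for a
        using is_glb_lower[OF \<delta>[OF yX]] that by blast
      have q\<eta>: "\<delta> y < \<eta>" using \<delta>_le[OF True] sym[of x y] y(2) by simp
      have "\<not> (\<forall>v\<in>{d y a | a. a \<in> A}. (1 + \<theta>) * \<delta> y \<le> v)"
      proof
        assume "\<forall>v\<in>{d y a | a. a \<in> A}. (1 + \<theta>) * \<delta> y \<le> v"
        then have "(1 + \<theta>) * \<delta> y \<le> \<delta> y" by (intro is_glb_greatest[OF \<delta>[OF yX]]) blast
        then show False using mult_pos_pos[OF \<theta>(1) q0] by (simp add: distrib_right)
      qed
      then obtain a where a: "a \<in> A" "d y a < (1 + \<theta>) * \<delta> y" by (auto simp: not_le)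
      have "(1 + \<theta>) * \<delta> y \<le> (1 + \<theta>) * \<eta>" using q\<eta> \<theta>(1) by (intro mult_left_mono) auto
      then have da: "d x a < r" using a(2) y(2) tri[of x a y] \<eta>(1) by (simp add: algebra_simps)
      have \<psi>a: "\<psi> a \<le> k + e / 2"
        using r(2)[OF a(1) da] unfolding abs_less_iff by linarith
      have "J y \<le> \<psi> a * d y a" using is_glb_lower[OF J[OF yX]] a(1) by blast
      also have "\<dots> \<le> (k + e / 2) * d y a" using \<psi>a nonneg by (intro mult_right_mono)
      also have "\<dots> \<le> (k + e / 2) * ((1 + \<theta>) * \<delta> y)" using a(2) ke by (intro mult_left_mono) auto
      also have "\<dots> = ((k + e / 2) + (k + e / 2) * \<theta>) * \<delta> y" by (simp add: algebra_simps)
      also have "\<dots> = (k + 3 * e / 4) * \<delta> y" unfolding \<theta>(2) by (simp add: algebra_simps)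
      finally have upper: "J y / \<delta> y \<le> k + 3 * e / 4" using q0 by (simp add: pos_divide_le_eq)
      \<comment> \<open>All points of \<open>A\<close> compete in the infimum. Near
        \<open>x\<close>, \<open>\<psi> a\<close> is at least k - e/2 and d(y,a) at least
        \<open>\<delta> y\<close>. Far from \<open>x\<close>, the bound
        \<open>1 \<le> \<psi> a\<close> leaves at least d(y,a) >= r - \<open>\<eta>\<close> >= k
        \<open>\<eta>\<close>, which exceeds k \<open>\<delta> y\<close>.\<close>
      have "(k - e / 2) * \<delta> y \<le> J y"
      proof (rule is_glb_greatest[OF J[OF yX]])
        fix v assume "v \<in> {\<psi> a * d y a | a. a \<in> A}"
        then obtain a where a: "a \<in> A" and v: "v = \<psi> a * d y a" by auto
        have \<psi>: "0 \<le> \<psi> a" using ge1[OF a] by (rule order.trans[OF zero_le_one])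
        show "(k - e / 2) * \<delta> y \<le> v"
        proof (cases "d x a < r")
          case True
          then have "k - e / 2 \<le> \<psi> a" using r(2)[OF a True] unfolding abs_less_iff by linarith
          then have "(k - e / 2) * \<delta> y \<le> \<psi> a * \<delta> y" using q0 by (intro mult_right_mono) auto
          also have "\<dots> \<le> v" unfolding v using \<delta>_le[OF a] \<psi> by (rule mult_left_mono)
          finally show ?thesis .
        next
          case False
          have "(k - e / 2) * \<delta> y \<le> k * \<delta> y" using q0 e by (intro mult_right_mono) auto
          also have "\<dots> \<le> k * \<eta>" using q\<eta> k by (intro mult_left_mono) auto
          also have "\<dots> \<le> r - \<eta>" using \<eta>(2) by (simp add: algebra_simps)
          also have "\<dots> \<le> d y a" using False tri[of x a y] y(2) by simp
          also have "\<dots> \<le> v" unfolding v using mult_right_mono[OF ge1[OF a] nonneg[of y a]] by simp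
          finally show ?thesis .
        qed
      qed
      then have lower: "k - e / 2 \<le> J y / \<delta> y" using q0 by (simp add: pos_le_divide_eq)
      have "- e < - (e / 2)" "3 * e / 4 < e" using e by auto
      then have "\<bar>J y / \<delta> y - k\<bar> < e"
        using upper lower unfolding abs_less_iff by linarith
      then show ?thesis using True yA by (simp add: k_def)
    qed
  qed
qed

section \<open>Definable predicates and functions\<close>

locale expansion =
  fixes D :: "nat \<Rightarrow> 'a::linordered_field list set set"
  assumes structure_D: "expansion_structure D"
begin

lemma D_subset: "A \<in> D n \<Longrightarrow> A \<subseteq> fsp n"
  and D_empty: "{} \<in> D n"
  and D_Un: "A \<in> D n \<Longrightarrow> B \<in> D n \<Longrightarrow> A \<union> B \<in> D n"
  and D_compl: "A \<in> D n \<Longrightarrow> fsp n - A \<in> D n"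
  and D_Cons: "A \<in> D n \<Longrightarrow> {c # x | c x. x \<in> A} \<in> D (Suc n)"
  and D_diag: "i < n \<Longrightarrow> j < n \<Longrightarrow> {x \<in> fsp n. x ! i = x ! j} \<in> D n"
  and D_butlast: "A \<in> D (Suc n) \<Longrightarrow> butlast ` A \<in> D n"
  and D_less: "{[x, y] | x y. x < y} \<in> D 2"
  and D_add: "{[x, y, x + y] | x y. True} \<in> D 3"
  and D_mult: "{[x, y, x * y] | x y. True} \<in> D 3"
  and D_const: "{[c]} \<in> D 1"
proof -
  note [simp del] = length_fsp
  note S = structure_D[unfolded expansion_structure_def]
  show "A \<in> D n \<Longrightarrow> A \<subseteq> fsp n" using S by simp
  show "{} \<in> D n" using S by simp
  show "A \<in> D n \<Longrightarrow> B \<in> D n \<Longrightarrow> A \<union> B \<in> D n" using S by simp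
  show "A \<in> D n \<Longrightarrow> fsp n - A \<in> D n" using S by simp
  show "A \<in> D n \<Longrightarrow> {c # x | c x. x \<in> A} \<in> D (Suc n)" using S by simp
  show "i < n \<Longrightarrow> j < n \<Longrightarrow> {x \<in> fsp n. x ! i = x ! j} \<in> D n" using S by simp
  show "A \<in> D (Suc n) \<Longrightarrow> butlast ` A \<in> D n" using S by simp
  show "{[x, y] | x y. x < y} \<in> D 2" using S by (elim conjE)
  show "{[x, y, x + y] | x y. True} \<in> D 3" using S by (elim conjE)
  show "{[x, y, x * y] | x y. True} \<in> D 3" using S by (elim conjE)
  show "{[c]} \<in> D 1" using S by simp
qed

text \<open>Definability of a predicate, a scalar function and a vector-valued function of \<open>N\<close> variables;
  only the values on lists of length \<open>N\<close> matter.\<close>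

definition dfp :: "nat \<Rightarrow> ('a list \<Rightarrow> bool) \<Rightarrow> bool" where
  "dfp N P \<longleftrightarrow> {x \<in> fsp N. P x} \<in> D N"

definition dft :: "nat \<Rightarrow> ('a list \<Rightarrow> 'a) \<Rightarrow> bool" where
  "dft N t \<longleftrightarrow> dfp (Suc N) (\<lambda>z. t (take N z) = z ! N)"

definition dfv :: "nat \<Rightarrow> nat \<Rightarrow> ('a list \<Rightarrow> 'a list) \<Rightarrow> bool" where
  "dfv N k h \<longleftrightarrow> (\<forall>x\<in>fsp N. h x \<in> fsp k) \<and> (\<forall>i<k. dft N (\<lambda>x. h x ! i))"

section \<open>Connectives, projections and changes of variables\<close>

lemma dfp_cong:
  assumes "\<And>x. length x = N \<Longrightarrow> P x = Q x"
  shows "dfp N P \<longleftrightarrow> dfp N Q"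
proof -
  have "{x \<in> fsp N. P x} = {x \<in> fsp N. Q x}" using assms by auto
  then show ?thesis by (simp only: dfp_def)
qed

lemma dfp_D:
  assumes "A \<in> D n"
  shows "dfp n (\<lambda>x. x \<in> A)"
proof -
  have "{x \<in> fsp n. x \<in> A} = A" using D_subset[OF assms] by auto
  with assms show ?thesis by (simp add: dfp_def del: length_fsp)
qed

lemma dfp_not: "dfp N P \<Longrightarrow> dfp N (\<lambda>x. \<not> P x)"
proof -
  assume "dfp N P"
  then have "fsp N - {x \<in> fsp N. P x} \<in> D N" unfolding dfp_def by (rule D_compl)
  moreover have "fsp N - {x \<in> fsp N. P x} = {x \<in> fsp N. \<not> P x}" by auto
  ultimately show ?thesis by (simp add: dfp_def)
qed

lemma dfp_disj: "dfp N P \<Longrightarrow> dfp N Q \<Longrightarrow> dfp N (\<lambda>x. P x \<or> Q x)"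
proof -
  assume "dfp N P" "dfp N Q"
  then have "{x \<in> fsp N. P x} \<union> {x \<in> fsp N. Q x} \<in> D N" unfolding dfp_def by (rule D_Un)
  moreover have "{x \<in> fsp N. P x} \<union> {x \<in> fsp N. Q x} = {x \<in> fsp N. P x \<or> Q x}" by auto
  ultimately show ?thesis by (simp add: dfp_def)
qed

lemma dfp_conj: "dfp N P \<Longrightarrow> dfp N Q \<Longrightarrow> dfp N (\<lambda>x. P x \<and> Q x)"
  using dfp_not[OF dfp_disj[OF dfp_not dfp_not], of N P Q] by simp

lemma dfp_imp: "dfp N P \<Longrightarrow> dfp N Q \<Longrightarrow> dfp N (\<lambda>x. P x \<longrightarrow> Q x)"
  unfolding imp_conv_disj by (intro dfp_disj dfp_not)

lemma dfp_bool: "dfp N (\<lambda>x. b)"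
proof -
  have "dfp N (\<lambda>x. False)" using D_empty by (simp add: dfp_def)
  then show ?thesis using dfp_not[of N "\<lambda>x. False"] by (cases b) simp_all
qed

lemma dfp_all_less: "(\<And>i. i < k \<Longrightarrow> dfp N (P i)) \<Longrightarrow> dfp N (\<lambda>x. \<forall>i<(k::nat). P i x)"
proof (induction k)
  case 0
  show ?case using dfp_bool[of N True] by (simp only: not_less_zero simp_thms)
next
  case (Suc k)
  have "dfp N (\<lambda>x. P k x \<and> (\<forall>i<k. P i x))"
    using dfp_conj[OF Suc.prems[OF lessI] Suc.IH[OF Suc.prems[OF less_SucI]]] by assumption
  then show ?case by (simp only: All_less_Suc)
qed

lemma D_cylinder: "A \<in> D k \<Longrightarrow> {z \<in> fsp (N + k). drop N z \<in> A} \<in> D (N + k)"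
proof (induction N)
  case 0
  have "{z \<in> fsp (0 + k). drop 0 z \<in> A} = A" using D_subset[OF 0] by auto
  with 0 show ?case by simp
next
  case (Suc N)
  have "{z \<in> fsp (Suc N + k). drop (Suc N) z \<in> A}
      = {c # x | c x. x \<in> {z \<in> fsp (N + k). drop N z \<in> A}}" (is "?L = ?R")
  proof
    show "?L \<subseteq> ?R"
    proof
      fix z assume "z \<in> ?L"
      then show "z \<in> ?R" by (cases z) auto
    qed
  qed auto
  then show ?case using D_Cons[OF Suc.IH[OF Suc.prems]] by simp
qed

lemma D_take: "A \<in> D (N + k) \<Longrightarrow> take N ` A \<in> D N"
proof (induction k arbitrary: A)
  case 0
  then have "take N ` A = A" using D_subset[of A N] by (force simp: image_iff)
  with 0 show ?case by simp
next
  case (Suc k)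
  have "take N ` (butlast ` A) = take N ` A"
    unfolding image_image
    by (rule image_cong) (use D_subset[OF Suc.prems] in \<open>auto simp: take_butlast\<close>)
  then show ?case using Suc.IH[OF D_butlast, of A] Suc.prems by simp
qed

lemma dfp_exv:
  assumes "dfp (N + k) (\<lambda>z. P (take N z) (drop N z))"
  shows "dfp N (\<lambda>x. \<exists>y\<in>fsp k. P x y)"
proof -
  have "{x \<in> fsp N. \<exists>y\<in>fsp k. P x y} = take N ` {z \<in> fsp (N + k). P (take N z) (drop N z)}"
    (is "?L = ?R")
  proof
    show "?L \<subseteq> ?R"
    proof
      fix x assume "x \<in> ?L"
      then obtain y where "length x = N" "length y = k" "P x y" by auto
      then show "x \<in> ?R" by (intro image_eqI[of _ _ "x @ y"]) auto
    qed
    show "?R \<subseteq> ?L" by auto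
  qed
  then show ?thesis using D_take assms unfolding dfp_def by simp
qed

text \<open>The axioms add coordinates only at the ends of a list and project away only the last
  one. Permuting, repeating or omitting variables goes through a copy: append \<open>k\<close> fresh
  variables satisfying \<open>P\<close>, tie them to the selected old ones by diagonals, and project
  the fresh ones away.\<close>

lemma dfp_reindex:
  assumes "dfp k P" "length is = k" "set is \<subseteq> {..<N}"
  shows "dfp N (\<lambda>x. P (map ((!) x) is))"
proof -
  have "{z \<in> fsp (N + k). drop N z \<in> {x \<in> fsp k. P x}} = {z \<in> fsp (N + k). P (drop N z)}"
    by auto
  then have cyl: "dfp (N + k) (\<lambda>z. P (drop N z))"
    using D_cylinder[of "{x \<in> fsp k. P x}" k N] assms(1) by (simp only: dfp_def)
  have diag: "dfp (N + k) (\<lambda>z. \<forall>j<k. z ! (is ! j) = z ! (N + j))"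
  proof (rule dfp_all_less)
    fix j assume "j < k"
    moreover have "is ! j < N" using assms \<open>j < k\<close> nth_mem by fastforce
    ultimately show "dfp (N + k) (\<lambda>z. z ! (is ! j) = z ! (N + j))"
      unfolding dfp_def by (intro D_diag) auto
  qed
  have "dfp N (\<lambda>x. \<exists>y\<in>fsp k. map ((!) x) is = y \<and> P y)"
  proof (rule dfp_exv)
    have "(map ((!) (take N z)) is = drop N z) = (\<forall>j<k. z ! (is ! j) = z ! (N + j))"
      if "length z = N + k" for z :: "'a list"
    proof -
      have "is ! j < N" if "j < k" for j using assms that nth_mem by fastforce
      then show ?thesis using that assms(2) by (auto simp: list_eq_iff_nth_eq)
    qed
    then show "dfp (N + k) (\<lambda>z. map ((!) (take N z)) is = drop N z \<and> P (drop N z))"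
      using dfp_conj[OF diag cyl]
      by (subst dfp_cong[of _ _ "\<lambda>z. (\<forall>j<k. z ! (is ! j) = z ! (N + j)) \<and> P (drop N z)"]) auto
  qed
  then show ?thesis using assms(2) by simp
qed

lemma map_nth_prefix_snoc:
  "N \<le> length z \<Longrightarrow> map ((!) z) ([0..<N] @ [j]) = take N z @ [z ! j]"
  by (auto simp: list_eq_iff_nth_eq nth_append)

lemma dft_reindex:
  assumes "dft M t" "M \<le> N" "j < N"
  shows "dfp N (\<lambda>z. t (take M z) = z ! j)"
proof -
  have "dfp N (\<lambda>z. (\<lambda>w. t (take M w) = w ! M) (map ((!) z) ([0..<M] @ [j])))"
    using assms by (intro dfp_reindex[of "Suc M"]) (auto simp: dft_def)
  then show ?thesis
    by (subst dfp_cong[where Q = "\<lambda>z. (\<lambda>w. t (take M w) = w ! M) (map ((!) z) ([0..<M] @ [j]))"])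
       (use assms in \<open>auto simp: map_nth_prefix_snoc nth_append simp del: map_append\<close>)
qed

text \<open>\<open>P (h x)\<close> says that some \<open>y\<close> satisfies \<open>P\<close> and
  agrees with \<open>h x\<close> in each coordinate: a projection of finitely many conditions on the
  graphs of the coordinates of \<open>h\<close>.\<close>

lemma dfp_subst:
  assumes "dfv M k h" "dfp k P"
  shows "dfp M (\<lambda>x. P (h x))"
proof -
  have "dfp M (\<lambda>x. \<exists>y\<in>fsp k. (\<forall>i<k. h x ! i = y ! i) \<and> P y)"
  proof (rule dfp_exv, rule dfp_conj)
    have "dfp (M + k) (\<lambda>z. \<forall>i<k. h (take M z) ! i = z ! (M + i))"
    proof (rule dfp_all_less)
      fix i assume "i < k"
      then show "dfp (M + k) (\<lambda>z. h (take M z) ! i = z ! (M + i))"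
        using dft_reindex[of M "\<lambda>x. h x ! i" "M + k" "M + i"] assms(1) by (simp add: dfv_def)
    qed
    then show "dfp (M + k) (\<lambda>z. \<forall>i<k. h (take M z) ! i = drop M z ! i)"
      by (subst dfp_cong[where Q = "\<lambda>z. \<forall>i<k. h (take M z) ! i = z ! (M + i)"]) auto
    have "dfp (M + k) (\<lambda>z. P (map ((!) z) [M..<M + k]))"
      using assms(2) by (intro dfp_reindex[of k]) auto
    then show "dfp (M + k) (\<lambda>z. P (drop M z))"
      by (subst dfp_cong[where Q = "\<lambda>z. P (map ((!) z) [M..<M + k])"])
         (auto intro!: arg_cong[where f = P] simp: list_eq_iff_nth_eq)
  qed
  moreover have "(\<exists>y\<in>fsp k. (\<forall>i<k. h x ! i = y ! i) \<and> P y) = P (h x)" if "length x = M" for x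
  proof -
    have "length (h x) = k" using assms(1) that by (auto simp: dfv_def)
    then have "(\<forall>i<k. h x ! i = y ! i) \<longleftrightarrow> y = h x" if "y \<in> fsp k" for y
      using that by (auto simp: list_eq_iff_nth_eq)
    then show ?thesis using \<open>length (h x) = k\<close> by auto
  qed
  ultimately show ?thesis by (simp cong: dfp_cong)
qed

section \<open>Composition and assembly of definable maps\<close>

lemma dft_weaken:
  assumes "dft M t" "M \<le> N"
  shows "dft N (\<lambda>z. t (take M z))"
  unfolding dft_def using dft_reindex[OF assms(1), of "Suc N" N] assms(2) by (simp add: min_def)

lemma dft_var: "i < M \<Longrightarrow> dft M (\<lambda>x. x ! i)"
  unfolding dft_def
  by (subst dfp_cong[where Q = "\<lambda>z. z ! i = z ! M"]) (auto simp: dfp_def D_diag[simplified])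

lemma dfv_id: "dfv M M (\<lambda>x. x)"
  by (simp add: dfv_def dft_var)

lemma dfv_Nil: "dfv M 0 (\<lambda>x. [])"
  by (simp add: dfv_def)

lemma dfv_Cons: "dft M t \<Longrightarrow> dfv M k h \<Longrightarrow> dfv M (Suc k) (\<lambda>x. t x # h x)"
  unfolding dfv_def by (auto simp: less_Suc_eq_0_disj)

lemma dft_cong: "(\<And>x. length x = M \<Longrightarrow> s x = t x) \<Longrightarrow> dft M s \<longleftrightarrow> dft M t"
  unfolding dft_def by (rule dfp_cong) simp

lemma dfv_append:
  assumes "dfv M k h" "dfv M l f"
  shows "dfv M (k + l) (\<lambda>x. h x @ f x)"
  unfolding dfv_def
proof (intro conjI allI impI ballI)
  fix i assume "i < k + l"
  have "dft M (\<lambda>x. if i < k then h x ! i else f x ! (i - k))"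
    using assms \<open>i < k + l\<close> by (cases "i < k") (auto simp: dfv_def)
  then show "dft M (\<lambda>x. (h x @ f x) ! i)"
    by (subst dft_cong[where t = "\<lambda>x. if i < k then h x ! i else f x ! (i - k)"])
       (use assms in \<open>auto simp: dfv_def nth_append\<close>)
qed (use assms in \<open>auto simp: dfv_def\<close>)

lemma dfv_weaken: "dfv M k h \<Longrightarrow> M \<le> N \<Longrightarrow> dfv N k (\<lambda>z. h (take M z))"
  by (auto simp: dfv_def intro: dft_weaken[where t = "\<lambda>x. h x ! _"])

lemma dft_subst:
  assumes "dfv M k h" "dft k t"
  shows "dft M (\<lambda>x. t (h x))"
proof -
  have "dfv (Suc M) (k + Suc 0) (\<lambda>z. h (take M z) @ [z ! M])"
    by (rule dfv_append[OF dfv_weaken[OF assms(1)] dfv_Cons[OF dft_var dfv_Nil]]) simp_all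
  moreover have "dfp (k + Suc 0) (\<lambda>w. t (take k w) = w ! k)"
    using assms(2) by (simp add: dft_def)
  ultimately have "dfp (Suc M) (\<lambda>z. t (take k (h (take M z) @ [z ! M])) = (h (take M z) @ [z ! M]) ! k)"
    by (rule dfp_subst)
  then show ?thesis unfolding dft_def
    by (subst dfp_cong[where Q = "\<lambda>z. t (take k (h (take M z) @ [z ! M])) = (h (take M z) @ [z ! M]) ! k"])
       (use assms(1) in \<open>auto simp: dfv_def nth_append\<close>)
qed

lemma dft_nth: "dfv M k h \<Longrightarrow> i < k \<Longrightarrow> dft M (\<lambda>x. h x ! i)"
  by (simp add: dfv_def)

lemma dfv_take:
  assumes "dfv M k h" "n \<le> k"
  shows "dfv M n (\<lambda>x. take n (h x))"
  unfolding dfv_def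
proof (intro conjI allI impI ballI)
  fix i assume "i < n"
  then show "dft M (\<lambda>x. take n (h x) ! i)" using dft_nth[OF assms(1)] assms(2) by simp
qed (use assms in \<open>auto simp: dfv_def\<close>)

lemma dfv_drop:
  assumes "dfv M (n + k) h"
  shows "dfv M k (\<lambda>x. drop n (h x))"
  unfolding dfv_def
proof (intro conjI allI impI ballI)
  fix i assume "i < k"
  then show "dft M (\<lambda>x. drop n (h x) ! i)"
    using dft_nth[OF assms(1), of "n + i"]
    by (subst dft_cong[where t = "\<lambda>x. h x ! (n + i)"]) (use assms in \<open>auto simp: dfv_def\<close>)
qed (use assms in \<open>auto simp: dfv_def\<close>)

section \<open>Order, field operations and scalar quantifiers\<close>

lemma dfp_less:
  assumes "dft M s" "dft M t"
  shows "dfp M (\<lambda>x. s x < t x)"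
  using dfp_subst[OF dfv_Cons[OF assms(1) dfv_Cons[OF assms(2) dfv_Nil]], of "\<lambda>x. x \<in> {[x, y] | x y. x < y}"]
    dfp_D[OF D_less] by (simp add: numeral_2_eq_2)

lemma dfp_le: "dft M s \<Longrightarrow> dft M t \<Longrightarrow> dfp M (\<lambda>x. s x \<le> t x)"
  using dfp_not[OF dfp_less, of M t s] by (simp add: not_less)

lemma dfp_eq: "dft M s \<Longrightarrow> dft M t \<Longrightarrow> dfp M (\<lambda>x. s x = t x)"
  using dfp_conj[OF dfp_le dfp_le, of M s t t s] by (simp add: eq_iff)

lemma dft_const: "dft M (\<lambda>x. c)"
proof -
  have "dfp (Suc M) (\<lambda>z. [z ! M] \<in> {[c]})"
    using dfp_D[OF D_const[of c]]
    by (intro dfp_subst[where P = "\<lambda>x. x \<in> {[c]}", OF dfv_Cons[OF dft_var dfv_Nil]]) simp_all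
  then show ?thesis unfolding dft_def by (simp add: eq_commute)
qed

text \<open>Operations that the structure axioms do not mention, such as difference, quotient, case
  distinction and infimum, can thus be introduced by any formula for their graph.\<close>

lemma dft_by_graph:
  assumes "dfp (Suc M) (\<lambda>z. Q (take M z) (z ! M))"
    and "\<And>x y. length x = M \<Longrightarrow> Q x y \<longleftrightarrow> t x = y"
  shows "dft M t"
  unfolding dft_def using assms(1)
  by (subst dfp_cong[where Q = "\<lambda>z. Q (take M z) (z ! M)"]) (auto simp: assms(2))

lemma dft_add:
  assumes "dft M s" "dft M t"
  shows "dft M (\<lambda>x. s x + t x)"
proof -
  have "dfv (Suc M) 3 (\<lambda>z. [s (take M z), t (take M z), z ! M])"
    using dfv_Cons[OF dft_weaken[OF assms(1)] dfv_Cons[OF dft_weaken[OF assms(2)]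
        dfv_Cons[OF dft_var dfv_Nil]], of "Suc M" M] by (simp add: numeral_3_eq_3)
  then have "dfp (Suc M) (\<lambda>z. [s (take M z), t (take M z), z ! M] \<in> {[x, y, x + y] | x y. True})"
    by (rule dfp_subst[OF _ dfp_D[OF D_add]])
  then show ?thesis unfolding dft_def by (simp add: eq_commute)
qed

lemma dft_mult:
  assumes "dft M s" "dft M t"
  shows "dft M (\<lambda>x. s x * t x)"
proof -
  have "dfv (Suc M) 3 (\<lambda>z. [s (take M z), t (take M z), z ! M])"
    using dfv_Cons[OF dft_weaken[OF assms(1)] dfv_Cons[OF dft_weaken[OF assms(2)]
        dfv_Cons[OF dft_var dfv_Nil]], of "Suc M" M] by (simp add: numeral_3_eq_3)
  then have "dfp (Suc M) (\<lambda>z. [s (take M z), t (take M z), z ! M] \<in> {[x, y, x * y] | x y. True})"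
    by (rule dfp_subst[OF _ dfp_D[OF D_mult]])
  then show ?thesis unfolding dft_def by (simp add: eq_commute)
qed

lemma dft_diff:
  assumes "dft M s" "dft M t"
  shows "dft M (\<lambda>x. s x - t x)"
  by (rule dft_by_graph[where Q = "\<lambda>x y. s x = y + t x"])
     (use assms in \<open>auto intro!: dfp_eq dft_add dft_var dft_weaken\<close>)

lemma dft_divide:
  assumes "dft M s" "dft M t"
  shows "dft M (\<lambda>x. s x / t x)"
  \<comment> \<open>The first disjunct records the convention that division by zero yields
    0.\<close>
  by (rule dft_by_graph[where Q = "\<lambda>x y. t x = 0 \<and> y = 0 \<or> t x \<noteq> 0 \<and> s x = y * t x"])
     (use assms in \<open>auto simp: nonzero_divide_eq_eq split: if_splits intro!: dfp_eq dfp_conj dfp_disj dfp_not dft_mult dft_const dft_var dft_weaken\<close>)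

lemma dfp_weaken: "dfp M P \<Longrightarrow> M \<le> N \<Longrightarrow> dfp N (\<lambda>z. P (take M z))"
  by (rule dfp_subst[OF dfv_take[OF dfv_id]])

lemma dft_if:
  assumes "dfp M P" "dft M s" "dft M t"
  shows "dft M (\<lambda>x. if P x then s x else t x)"
  by (rule dft_by_graph[where Q = "\<lambda>x y. P x \<and> s x = y \<or> \<not> P x \<and> t x = y"])
     (use assms in \<open>auto intro!: dfp_eq dfp_conj dfp_disj dfp_not dft_var dft_weaken dfp_weaken\<close>)

lemma dft_max: "dft M s \<Longrightarrow> dft M t \<Longrightarrow> dft M (\<lambda>x. max (s x) (t x))"
  unfolding max_def by (intro dft_if dfp_le)

lemma dft_uminus: "dft M s \<Longrightarrow> dft M (\<lambda>x. - s x)"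
  using dft_diff[OF dft_const, of M s 0] by simp

lemma dft_abs: "dft M s \<Longrightarrow> dft M (\<lambda>x. \<bar>s x\<bar>)"
  unfolding abs_if by (intro dft_if dfp_less dft_uminus dft_const)

lemma dfp_allv:
  assumes "dfp (N + k) (\<lambda>z. P (take N z) (drop N z))"
  shows "dfp N (\<lambda>x. \<forall>y\<in>fsp k. P x y)"
  using dfp_not[OF dfp_exv[where P = "\<lambda>x y. \<not> P x y", OF dfp_not[OF assms]]] by simp

lemma dfp_ex:
  assumes "dfp (Suc N) (\<lambda>z. P (take N z) (z ! N))"
  shows "dfp N (\<lambda>x. \<exists>y. P x y)"
proof -
  have "dfp N (\<lambda>x. \<exists>y\<in>fsp 1. P x (y ! 0))"
    using assms by (intro dfp_exv) (subst dfp_cong, auto)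
  moreover have "(\<exists>y\<in>fsp 1. P x (y ! 0)) = (\<exists>y. P x y)" for x
    by (auto intro!: bexI[of _ "[_]"])
  ultimately show ?thesis by simp
qed

lemma dfp_all:
  assumes "dfp (Suc N) (\<lambda>z. P (take N z) (z ! N))"
  shows "dfp N (\<lambda>x. \<forall>y. P x y)"
  using dfp_not[OF dfp_ex[where P = "\<lambda>x y. \<not> P x y", OF dfp_not[OF assms]]] by simp

lemma dfv_const: "dfv M (length c) (\<lambda>x. c)"
  by (simp add: dfv_def dft_const)

text \<open>Repeated application follows the syntax of a formula through connectives, quantifiers
  and terms, so that a first-order description of a set serves as a proof of its
  definability.\<close>

lemmas dfn_intros = dfp_conj dfp_disj dfp_imp dfp_not dfp_bool dfp_exv dfp_allv dfp_ex dfp_all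
  dfp_less dfp_le dfp_eq dft_add dft_mult dft_diff dft_divide dft_max dft_uminus dft_abs dft_if
  dft_const dft_nth dfv_take dfv_drop dfv_append dfv_id

text \<open>Extension by 0 outside \<open>S\<close> turns a definable partial map into a total one,
  the form in which substitution works.\<close>

lemma dft_total:
  assumes "def_fun D M k S f" "S \<in> D M" "\<And>x. x \<in> S \<Longrightarrow> f x \<in> fsp k" "i < k"
  shows "dft M (\<lambda>x. if x \<in> S then f x ! i else 0)"
proof (rule dft_by_graph)
  let ?Q = "\<lambda>x y. (\<exists>u\<in>fsp k. x @ u \<in> {x @ f x | x. x \<in> S} \<and> u ! i = y) \<or> x \<notin> S \<and> 0 = y"
  have graph: "dfp (M + k) (\<lambda>z. z \<in> {x @ f x | x. x \<in> S})"
    using assms(1) by (intro dfp_D) (simp add: def_fun_def)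
  show "dfp (Suc M) (\<lambda>z. ?Q (take M z) (z ! M))"
    by (rule dfn_intros dfp_subst[OF _ graph] dfp_subst[OF _ dfp_D[OF assms(2)]]
        | simp add: assms(4))+
  fix x :: "'a list" and y assume x: "length x = M"
  have S: "length v = M" if "v \<in> S" for v using D_subset[OF assms(2)] that by auto
  \<comment> \<open>A point of the graph splits into argument and value in one way only, as all
    arguments have length \<open>M\<close>.\<close>
  have "x @ u \<in> {x @ f x | x. x \<in> S} \<longleftrightarrow> x \<in> S \<and> u = f x" for u
  proof
    assume "x @ u \<in> {x @ f x | x. x \<in> S}"
    then obtain v where "x @ u = v @ f v" "v \<in> S" by blast
    then show "x \<in> S \<and> u = f x" using x S[of v] append_eq_append_conv[of x v u "f v"] by simp
  qed blast
  then show "?Q x y \<longleftrightarrow> (if x \<in> S then f x ! i else 0) = y"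
    using assms(3)[of x] by (simp del: length_fsp)
qed

lemma def_fun_dft:
  assumes "dft n f" "S \<in> D n"
  shows "def_fun D n 1 S (\<lambda>x. [f x])"
proof -
  have "dfp (Suc n) (\<lambda>z. take n z \<in> S \<and> f (take n z) = z ! n)"
    using assms by (intro dfp_conj dfp_weaken dfp_D) (auto simp: dft_def)
  moreover have "{z \<in> fsp (Suc n). take n z \<in> S \<and> f (take n z) = z ! n} = {x @ [f x] | x. x \<in> S}"
    (is "?L = ?R")
  proof
    show "?L \<subseteq> ?R"
    proof
      fix z assume "z \<in> ?L"
      then have "z = take n z @ [f (take n z)]" "take n z \<in> S"
        by (auto simp: take_Suc_conv_app_nth[symmetric])
      then show "z \<in> ?R" by blast
    qed
    show "?R \<subseteq> ?L" using D_subset[OF assms(2)] by (auto simp: nth_append)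
  qed
  ultimately show ?thesis by (simp add: def_fun_def dfp_def)
qed

lemma dfv_const': "length c = k \<Longrightarrow> dfv M k (\<lambda>x. c)"
  using dfv_const by blast

lemma dfp_subst2:
  assumes "dfp (Suc N) (\<lambda>z. R (take N z) (z ! N))" "dfv M N h" "dft M t"
  shows "dfp M (\<lambda>x. R (h x) (t x))"
proof -
  have "dfv M (Suc N) (\<lambda>x. h x @ [t x])"
    using dfv_append[OF assms(2) dfv_Cons[OF assms(3) dfv_Nil]] by simp
  then have "dfp M (\<lambda>x. R (take N (h x @ [t x])) ((h x @ [t x]) ! N))"
    by (rule dfp_subst[OF _ assms(1)])
  then show ?thesis
    by (subst dfp_cong[where Q = "\<lambda>x. R (take N (h x @ [t x])) ((h x @ [t x]) ! N)"])
       (use assms(2) in \<open>auto simp: dfv_def nth_append\<close>)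
qed

lemma dft_subst2:
  assumes "dft (m + n) F" "dfv M m h" "dfv M n f"
  shows "dft M (\<lambda>x. F (h x @ f x))"
  by (rule dft_subst[OF dfv_append[OF assms(2,3)] assms(1)])

lemma dft_sdist:
  assumes "dfv M k h" "n \<le> k" "dfv M l f" "n \<le> l"
  shows "dft M (\<lambda>x. sdist n (h x) (f x))"
  using assms(2,4)
proof (induction n)
  case 0
  then show ?case by (simp add: dft_const)
next
  case (Suc n)
  then have "dft M (\<lambda>x. max (sdist n (h x) (f x)) \<bar>h x ! n - f x ! n\<bar>)"
    by (intro dft_max dft_abs dft_diff dft_nth[OF assms(1)] dft_nth[OF assms(3)]) auto
  then show ?case by simp
qed

text \<open>Being a greatest lower bound is a first-order condition on the candidate, and so is the
  absence of one, where the value is 0.\<close>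

lemma dft_infF:
  assumes "dfp (Suc N) (\<lambda>z. R (take N z) (z ! N))"
  shows "dft N (\<lambda>x. infF {v. R x v})"
proof (rule dft_by_graph)
  let ?G = "\<lambda>x s. (\<forall>v. R x v \<longrightarrow> s \<le> v) \<and> (\<forall>b. (\<forall>v. R x v \<longrightarrow> b \<le> v) \<longrightarrow> b \<le> s)"
  note R = dfp_subst2[OF assms]
  show "dfp (Suc N) (\<lambda>z. ?G (take N z) (z ! N) \<or> \<not> (\<exists>s. ?G (take N z) s) \<and> z ! N = 0)"
    by (rule dfn_intros R | simp)+
  fix x y
  have G: "?G x s \<longleftrightarrow> is_glb {v. R x v} s" for s by (auto simp: is_glb_def)
  show "?G x y \<or> \<not> (\<exists>s. ?G x s) \<and> y = 0 \<longleftrightarrow> infF {v. R x v} = y"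
    unfolding G
  proof (cases "\<exists>s. is_glb {v. R x v} s")
    case True
    then show "is_glb {v. R x v} y \<or> \<not> (\<exists>s. is_glb {v. R x v} s) \<and> y = 0 \<longleftrightarrow> infF {v. R x v} = y"
      using is_glb_infF by metis
  qed (auto simp: infF_def)
qed

end

section \<open>Definable completeness and compactness\<close>

locale complete_expansion = expansion D for D :: "nat \<Rightarrow> 'a::linordered_field list set set" +
  assumes complete: "definably_complete D"
begin

text \<open>Once the parameters \<open>x\<close> are frozen, which is possible because constants are
  definable, the values form a definable subset of the line, and definable completeness
  applies.\<close>

lemma is_glb_inf:
  assumes R: "dfp (Suc N) (\<lambda>z. R (take N z) (z ! N))" and x: "length x = N"
    and ne: "R x v" and lower: "\<And>v. R x v \<Longrightarrow> b \<le> v"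
  shows "is_glb {v. R x v} (infF {v. R x v})"
proof -
  have "dfp 1 (\<lambda>z. R x (z ! 0))"
    by (rule dfp_subst2[OF R dfv_const'[OF x] dft_var]) simp
  moreover have "{z \<in> fsp 1. R x (z ! 0)} = {[s] | s. s \<in> {v. R x v}}"
    by (auto simp: length_Suc_conv)
  ultimately have D1: "{[s] | s. s \<in> {v. R x v}} \<in> D 1" by (simp only: dfp_def)
  have "{v. R x v} \<noteq> {} \<and> (\<exists>b. \<forall>v\<in>{v. R x v}. b \<le> v)" using ne lower by auto
  from mp[OF conjunct2[OF mp[OF spec[OF complete[unfolded definably_complete_def]] D1]] this]
  obtain s where "is_glb {v. R x v} s" unfolding is_glb_def by (elim exE)
  then show ?thesis using is_glb_infF by metis
qed

text \<open>A cluster point of a decreasing definable family as \<open>t \<rightarrow> 0\<close>, found one coordinate at a time: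
  coordinate \<open>i\<close> is a limit inferior over those members of the family that are
  already close to the cluster point in the earlier coordinates.\<close>

lemma definable_cluster_point:
  assumes Q: "dfp (Suc m) (\<lambda>z. Q (take m z) (z ! m))"
    and mono: "\<And>g s t. Q g s \<Longrightarrow> 0 < s \<Longrightarrow> s \<le> t \<Longrightarrow> Q g t"
    and ne: "\<And>t. 0 < t \<Longrightarrow> \<exists>g\<in>fsp m. Q g t"
    and bounded: "\<And>g t i. 0 < t \<Longrightarrow> Q g t \<Longrightarrow> i < m \<Longrightarrow> \<bar>g ! i\<bar> \<le> r"
  shows "\<exists>c\<in>fsp m. \<forall>t>0. \<exists>g\<in>fsp m. Q g t \<and> sdist m g c \<le> t"
proof -
  have "\<exists>c\<in>fsp i. \<forall>t>0. \<exists>g\<in>fsp m. Q g t \<and> sdist i g c \<le> t" if "i \<le> m" for i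
    using that
  proof (induction i)
    case 0
    then show ?case using ne by auto
  next
    case (Suc i)
    then obtain c where c: "length c = i" "\<And>t. 0 < t \<Longrightarrow> \<exists>g\<in>fsp m. Q g t \<and> sdist i g c \<le> t"
      by auto
    \<comment> \<open>The infimum of these \<open>v\<close> is the limit inferior of coordinate
      \<open>i\<close> along members close to \<open>c\<close>. The dummy argument \<open>x\<close>
      gives \<open>R\<close> the shape that \<open>is_glb_inf\<close> expects, with no
      parameters.\<close>
    define R where "R x v \<longleftrightarrow> (\<forall>t. 0 < t \<longrightarrow> (\<exists>g\<in>fsp m. Q g t \<and> sdist i g c \<le> t \<and> g ! i \<le> v))"
      for x :: "'a list" and v
    have "dfp (Suc 0) (\<lambda>z. R (take 0 z) (z ! 0))"
      unfolding R_def
      by (rule dfn_intros dfp_subst2[OF Q] dft_sdist dfv_const'[OF c(1)] | use Suc.prems in simp)+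
    then have glb: "is_glb {v. R [] v} (infF {v. R [] v})"
    proof (rule is_glb_inf)
      show "R [] r"
        unfolding R_def
      proof (intro allI impI)
        fix t :: 'a assume "0 < t"
        then show "\<exists>g\<in>fsp m. Q g t \<and> sdist i g c \<le> t \<and> g ! i \<le> r"
          using c(2)[of t] bounded[where t = t] Suc.prems by (fastforce simp: abs_le_iff)
      qed
      show "- r \<le> v" if "R [] v" for v
      proof -
        obtain g where "Q g 1" "g ! i \<le> v"
          using \<open>R [] v\<close> zero_less_one[where 'a = 'a] unfolding R_def by blast
        then show ?thesis using bounded[where t = 1 and g = g and i = i] Suc.prems by (simp add: abs_le_iff)
      qed
    qed simp
    define s where "s = infF {v. R [] v}"
    have "\<exists>g\<in>fsp m. Q g t \<and> sdist (Suc i) g (c @ [s]) \<le> t" if t: "0 < t" for t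
    proof -
      obtain v where "R [] v" "v < s + t"
        using is_glb_greatest[OF glb, of "s + t"] t unfolding s_def by force
      have "\<not> R [] (s - t)"
        using is_glb_lower[OF glb, of "s - t"] t unfolding s_def by auto
      then obtain t0 where t0: "0 < t0"
        "\<And>g. g \<in> fsp m \<Longrightarrow> Q g t0 \<Longrightarrow> sdist i g c \<le> t0 \<Longrightarrow> s - t < g ! i"
        unfolding R_def by (meson not_le)
      \<comment> \<open>One scale serves both bounds: \<open>R [] v\<close> supplies a
        \<open>g\<close> there with coordinate \<open>i\<close> at most v < s + t, and by
        monotonicity this \<open>g\<close> also meets the conditions at scale \<open>t0\<close>,
        which force s - t below that coordinate.\<close>
      have "0 < min t t0" using t t0(1) by simp
      then obtain g where g: "g \<in> fsp m" "Q g (min t t0)" "sdist i g c \<le> min t t0" "g ! i \<le> v"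
        using \<open>R [] v\<close> unfolding R_def by blast
      have "s - t < g ! i" "Q g t"
        using g mono[of g "min t t0"] t t0 by auto
      moreover have "sdist i g (c @ [s]) = sdist i g c"
        using sdist_append[of i c] c(1) by simp
      ultimately show ?thesis
        using g c(1) \<open>v < s + t\<close> by (intro bexI[of _ g]) (auto simp: nth_append abs_le_iff algebra_simps)
    qed
    then show ?case using c(1) by (intro bexI[of _ "c @ [s]"]) auto
  qed
  then show ?thesis by blast
qed

text \<open>A substitute for finite subcovers. If no \<open>t\<close> served all of
  \<open>G\<close>, the sets of points where \<open>P\<close> fails at scale \<open>t\<close> would
  be nonempty and shrink with \<open>t\<close>. They would have a cluster point, which lies in
  \<open>G\<close> because \<open>G\<close> is closed, and \<open>loc\<close> fails there.\<close>

lemma definably_compact_uniform: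
  assumes P: "dfp (Suc m) (\<lambda>z. P (take m z) (z ! m))"
    and G: "definably_compact D m G"
    and mono: "\<And>g s t. P g t \<Longrightarrow> 0 < s \<Longrightarrow> s \<le> t \<Longrightarrow> P g s"
    and loc: "\<And>c. c \<in> G \<Longrightarrow> \<exists>t>0. \<forall>g\<in>G. sdist m c g < t \<longrightarrow> P g t"
  shows "\<exists>t>0. \<forall>g\<in>G. P g t"
proof (rule ccontr)
  assume neg: "\<not> ?thesis"
  let ?Q = "\<lambda>g t. g \<in> G \<and> \<not> P g t"
  have G': "G \<in> D m" "closedF m G" "boundedF m G" using G by (auto simp: definably_compact_def)
  then obtain r where r: "\<And>g i. g \<in> G \<Longrightarrow> i < m \<Longrightarrow> \<bar>g ! i\<bar> \<le> r"
    unfolding boundedF_def by blast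
  have sub: "G \<subseteq> fsp m" using D_subset[OF G'(1)] .
  have "\<exists>c\<in>fsp m. \<forall>t>0. \<exists>g\<in>fsp m. ?Q g t \<and> sdist m g c \<le> t"
  proof (rule definable_cluster_point)
    show "dfp (Suc m) (\<lambda>z. ?Q (take m z) (z ! m))"
      by (intro dfp_conj dfp_not P dfp_subst[OF _ dfp_D[OF G'(1)]] dfv_take[OF dfv_id]) simp
    show "\<exists>g\<in>fsp m. ?Q g t" if "0 < t" for t using neg that sub by blast
    show "?Q g t" if "?Q g s" "0 < s" "s \<le> t" for g s t using mono that by blast
    show "\<bar>g ! i\<bar> \<le> r" if "?Q g t" "i < m" for g t i using r that by blast
  qed
  then obtain c where c: "length c = m" "\<And>t. 0 < t \<Longrightarrow> \<exists>g. ?Q g t \<and> sdist m g c \<le> t"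
    by (metis length_fsp)
  \<comment> \<open>Halving the scale makes the distance bound strict, while failure of
    \<open>P\<close> at \<open>t / 2\<close> still excludes \<open>P\<close> at \<open>t\<close> by
    \<open>mono\<close>.\<close>
  have less: "\<exists>g. ?Q g (t / 2) \<and> sdist m c g < t" if "0 < t" for t
  proof -
    obtain g where "?Q g (t / 2)" "sdist m c g \<le> t / 2"
      using c(2)[of "t / 2"] \<open>0 < t\<close> by (auto simp: sdist_commute[of m c])
    moreover have "t / 2 < t" using that by simp
    ultimately show ?thesis by (meson le_less_trans)
  qed
  have "c \<in> G"
  proof (rule ccontr)
    assume "c \<notin> G"
    then obtain e where "0 < e" "box m c e \<subseteq> fsp m - G"
      using G'(2) c(1) unfolding closedF_def openF_def by (metis DiffI length_fsp)
    then show False using less[of e] sub by (auto simp: box_iff subset_iff)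
  qed
  then obtain t where "0 < t" "\<forall>g\<in>G. sdist m c g < t \<longrightarrow> P g t" using loc by blast
  then show False using less[of t] mono[of _ t "t / 2"] by auto
qed

text \<open>\<open>definably_compact_uniform\<close> enters twice: it bounds the values over
  \<open>G\<close> from below, so that the infimum exists, and it makes continuity at
  \<open>x\<close> uniform in \<open>g\<close>, so that the infima vary continuously.\<close>

lemma inf_over_definably_compact:
  assumes G: "definably_compact D m G" "G \<noteq> {}"
    and X: "X \<in> D n" and F: "dft (m + n) F"
    and cont: "\<And>g x e. g \<in> G \<Longrightarrow> x \<in> X \<Longrightarrow> 0 < e \<Longrightarrow>
      \<exists>r>0. \<forall>h\<in>G. \<forall>y\<in>X. sdist m g h < r \<longrightarrow> sdist n x y < r \<longrightarrow> \<bar>F (h @ y) - F (g @ x)\<bar> < e"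
  shows "dft n (\<lambda>x. infF {v. \<exists>g\<in>fsp m. g \<in> G \<and> v = F (g @ x)})" (is "dft n ?I")
    and "scont n X (\<lambda>x. infF {v. \<exists>g\<in>fsp m. g \<in> G \<and> v = F (g @ x)})"
proof -
  have GD: "G \<in> D m" using G by (simp add: definably_compact_def)
  have sub: "G \<subseteq> fsp m" using D_subset[OF GD] .
  note mem_G = dfp_subst[OF _ dfp_D[OF GD]] and mem_X = dfp_subst[OF _ dfp_D[OF X]]
  have R: "dfp (Suc n) (\<lambda>z. \<exists>g\<in>fsp m. g \<in> G \<and> z ! n = F (g @ take n z))"
    by (rule mem_G dfn_intros dft_subst2[OF F] | simp)+
  then show "dft n ?I" by (rule dft_infF)
  have glb: "is_glb {v. \<exists>g\<in>fsp m. g \<in> G \<and> v = F (g @ x)} (?I x)" if x: "x \<in> X" for x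
  proof -
    have len: "length x = n" using D_subset[OF X] x by auto
    \<comment> \<open>The lower bound -1/t, written without division; the condition passes to
      smaller \<open>t\<close>.\<close>
    have "\<exists>t>0. \<forall>g\<in>G. - 1 \<le> t * F (g @ x)"
    proof (rule definably_compact_uniform[OF _ G(1)])
      show "dfp (Suc m) (\<lambda>z. - 1 \<le> z ! m * F (take m z @ x))"
        by (rule dfn_intros dft_subst2[OF F] dfv_const'[OF len] | simp)+
      show "- 1 \<le> s * F (g @ x)" if "- 1 \<le> t * F (g @ x)" "0 < s" "s \<le> t" for g s t
      proof (cases "0 \<le> F (g @ x)")
        case True
        then have "0 \<le> s * F (g @ x)" using that by simp
        then show ?thesis by (rule order.trans[rotated]) simp
      next
        case False
        then have "t * F (g @ x) \<le> s * F (g @ x)" using that by (intro mult_right_mono_neg) auto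
        with that show ?thesis by simp
      qed
      fix c assume c: "c \<in> G"
      obtain r where r: "0 < r"
        "\<And>h y. h \<in> G \<Longrightarrow> y \<in> X \<Longrightarrow> sdist m c h < r \<Longrightarrow> sdist n x y < r \<Longrightarrow> \<bar>F (h @ y) - F (c @ x)\<bar> < 1"
        using cont[OF c x, of 1] by auto
      \<comment> \<open>Near \<open>c\<close> the values stay above the negative of
        \<open>\<bar>F (c @ x)\<bar> + 1\<close>, so its reciprocal is an admissible scale.\<close>
      let ?u = "1 / (\<bar>F (c @ x)\<bar> + 1)"
      have u: "0 < \<bar>F (c @ x)\<bar> + 1" by (simp add: add_nonneg_pos)
      have "sdist n x x < r" using r(1) by (simp add: sdist_less_iff)
      have "- 1 \<le> min r ?u * F (g @ x)" if g: "g \<in> G" "sdist m c g < min r ?u" for g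
      proof (cases "0 \<le> F (g @ x)")
        case True
        then have "0 \<le> min r ?u * F (g @ x)" using r(1) u by (intro mult_nonneg_nonneg) auto
        then show ?thesis by (rule order.trans[rotated]) simp
      next
        case False
        have "\<bar>F (g @ x) - F (c @ x)\<bar> < 1" using r(2)[OF g(1) x] g \<open>sdist n x x < r\<close> by simp
        then have "- F (g @ x) \<le> \<bar>F (c @ x)\<bar> + 1" by (auto simp: abs_if split: if_splits)
        then have "?u * (- F (g @ x)) \<le> ?u * (\<bar>F (c @ x)\<bar> + 1)" using u by (intro mult_left_mono) auto
        also have "\<dots> = 1" using u by simp
        finally have "?u * (- F (g @ x)) \<le> 1" .
        moreover have "min r ?u * (- F (g @ x)) \<le> ?u * (- F (g @ x))"
          using False by (intro mult_right_mono) auto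
        ultimately show ?thesis by simp
      qed
      then show "\<exists>t>0. \<forall>g\<in>G. sdist m c g < t \<longrightarrow> - 1 \<le> t * F (g @ x)"
        using r(1) u by (intro exI[of _ "min r ?u"]) auto
    qed
    then obtain t where t: "0 < t" "\<And>g. g \<in> G \<Longrightarrow> - 1 \<le> t * F (g @ x)" by blast
    obtain g where "g \<in> G" using G(2) by blast
    show ?thesis
    proof (rule is_glb_inf[OF R len])
      show "\<exists>g'\<in>fsp m. g' \<in> G \<and> F (g @ x) = F (g' @ x)" using \<open>g \<in> G\<close> sub by blast
      show "- 1 / t \<le> v" if "\<exists>g\<in>fsp m. g \<in> G \<and> v = F (g @ x)" for v
      proof -
        have "- 1 \<le> v * t" using t(2) that by (auto simp: mult.commute)
        then show ?thesis using t(1) by (simp only: pos_divide_le_eq)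
      qed
    qed
  qed
  show "scont n X ?I"
    unfolding scont_def
  proof (intro ballI allI impI)
    fix x and e :: 'a assume x: "x \<in> X" and e: "0 < e"
    have len: "length x = n" using D_subset[OF X] x by auto
    \<comment> \<open>The bound is \<open>e / 2\<close> because strict inequalities become weak ones
      on passing to the infimum.\<close>
    have "\<exists>t>0. \<forall>g\<in>G. \<forall>y\<in>fsp n. y \<in> X \<and> sdist n x y < t \<longrightarrow> \<bar>F (g @ y) - F (g @ x)\<bar> < e / 2"
    proof (rule definably_compact_uniform[OF _ G(1)])
      show "dfp (Suc m) (\<lambda>z. \<forall>y\<in>fsp n. y \<in> X \<and> sdist n x y < z ! m \<longrightarrow>
          \<bar>F (take m z @ y) - F (take m z @ x)\<bar> < e / 2)"
        by (rule mem_X dfn_intros dft_subst2[OF F] dft_sdist dfv_const'[OF len] | simp add: len)+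
      fix c assume c: "c \<in> G"
      \<comment> \<open>A quarter of \<open>e\<close>, since \<open>F (g @ y)\<close> and
        \<open>F (g @ x)\<close> are both compared with \<open>F (c @ x)\<close>.\<close>
      obtain r where r: "0 < r" "\<And>h y. h \<in> G \<Longrightarrow> y \<in> X \<Longrightarrow> sdist m c h < r \<Longrightarrow> sdist n x y < r \<Longrightarrow>
          \<bar>F (h @ y) - F (c @ x)\<bar> < e / 4"
        using cont[OF c x, of "e / 4"] e by auto
      have "sdist n x x < r" using r(1) by (simp add: sdist_less_iff)
      have tri: "\<bar>a - b\<bar> < e / 2" if "\<bar>a - k\<bar> < e / 4" "\<bar>b - k\<bar> < e / 4" for a b k :: 'a
        using that unfolding abs_less_iff by linarith
      show "\<exists>t>0. \<forall>g\<in>G. sdist m c g < t \<longrightarrow> (\<forall>y\<in>fsp n. y \<in> X \<and> sdist n x y < t \<longrightarrow>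
          \<bar>F (g @ y) - F (g @ x)\<bar> < e / 2)"
        using r x \<open>sdist n x x < r\<close> by (intro exI[of _ r]) (blast intro: tri)
    qed (meson less_le_trans)
    then obtain t where t: "0 < t"
      "\<And>g y. g \<in> G \<Longrightarrow> y \<in> X \<Longrightarrow> sdist n x y < t \<Longrightarrow> \<bar>F (g @ y) - F (g @ x)\<bar> < e / 2"
      using D_subset[OF X] by (meson subsetD)
    have le: "?I y \<le> ?I z + e / 2" if yz: "y \<in> X" "z \<in> X"
      "\<And>g. g \<in> G \<Longrightarrow> \<bar>F (g @ y) - F (g @ z)\<bar> < e / 2" for y z
    proof -
      have "?I y - e / 2 \<le> ?I z"
      proof (rule is_glb_greatest[OF glb[OF yz(2)]])
        fix v assume "v \<in> {v. \<exists>g\<in>fsp m. g \<in> G \<and> v = F (g @ z)}"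
        then obtain g where g: "g \<in> G" "v = F (g @ z)" by blast
        have "?I y \<le> F (g @ y)" using g sub by (intro is_glb_lower[OF glb[OF yz(1)]]) blast
        then show "?I y - e / 2 \<le> v" using yz(3)[OF g(1)] unfolding g(2) abs_less_iff by linarith
      qed
      then show ?thesis by (simp add: algebra_simps)
    qed
    have half: "e / 2 < e" using e by simp
    have "\<bar>?I y - ?I x\<bar> < e" if y: "y \<in> X" "sdist n x y < t" for y
    proof -
      have "?I y \<le> ?I x + e / 2" by (rule le[OF y(1) x t(2)[OF _ y]])
      moreover have "?I x \<le> ?I y + e / 2"
        using t(2)[OF _ y] by (intro le[OF x y(1)]) (simp add: abs_minus_commute)
      ultimately show ?thesis using half unfolding abs_less_iff by linarith
    qed
    then show "\<exists>r>0. \<forall>y\<in>X. sdist n x y < r \<longrightarrow> \<bar>?I y - ?I x\<bar> < e" using t(1) by blast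
  qed
qed

section \<open>Extension theorems\<close>

lemma hausdorff_extension:
  assumes A: "A \<in> D n" and X: "X \<in> D n" and closed: "closed_inF n A X"
    and \<psi>: "dft n \<psi>" "scont n A \<psi>" and ge1: "\<And>a. a \<in> A \<Longrightarrow> 1 \<le> \<psi> a"
  shows "\<exists>\<Psi>. dft n \<Psi> \<and> scont n X \<Psi> \<and> (\<forall>a\<in>A. \<Psi> a = \<psi> a)"
proof (cases "A = {}")
  case True
  \<comment> \<open>Over an empty \<open>A\<close> the infima of the formula do not exist; the zero
    function is an extension.\<close>
  have "scont n X (\<lambda>x. 0)" by (auto simp: scont_def intro: exI[of _ 1])
  then show ?thesis using True dft_const[of n 0] by auto
next
  case False
  then obtain a0 where a0: "a0 \<in> A" by blast
  have sub: "A \<subseteq> fsp n" "X \<subseteq> fsp n" using D_subset A X by auto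
  note mem_A = dfp_subst[OF _ dfp_D[OF A]]
  define J where "J x = infF {v. \<exists>a\<in>fsp n. a \<in> A \<and> v = \<psi> a * sdist n x a}" for x
  define \<delta> where "\<delta> x = infF {v. \<exists>a\<in>fsp n. a \<in> A \<and> v = sdist n x a}" for x
  have RJ: "dfp (Suc n) (\<lambda>z. \<exists>a\<in>fsp n. a \<in> A \<and> z ! n = \<psi> a * sdist n (take n z) a)"
    by (rule mem_A dfn_intros dft_subst[OF _ \<psi>(1)] dft_sdist | simp)+
  have R\<delta>: "dfp (Suc n) (\<lambda>z. \<exists>a\<in>fsp n. a \<in> A \<and> z ! n = sdist n (take n z) a)"
    by (rule mem_A dfn_intros dft_sdist | simp)+
  have \<psi>0: "0 \<le> \<psi> a" if "a \<in> A" for a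
    using ge1[OF that] by (rule order.trans[OF zero_le_one])
  have glb_J: "is_glb {\<psi> a * sdist n x a | a. a \<in> A} (J x)" if "x \<in> X" for x
  proof -
    have "is_glb {v. \<exists>a\<in>fsp n. a \<in> A \<and> v = \<psi> a * sdist n x a} (J x)"
      unfolding J_def
    proof (rule is_glb_inf[OF RJ])
      show "\<exists>a\<in>fsp n. a \<in> A \<and> \<psi> a0 * sdist n x a0 = \<psi> a * sdist n x a"
        using a0 sub by blast
    qed (use that sub in \<open>auto intro!: mult_nonneg_nonneg sdist_nonneg \<psi>0\<close>)
    moreover have "{v. \<exists>a\<in>fsp n. a \<in> A \<and> v = \<psi> a * sdist n x a} = {\<psi> a * sdist n x a | a. a \<in> A}"
      using sub by blast
    ultimately show ?thesis by simp
  qed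
  have glb_\<delta>: "is_glb {sdist n x a | a. a \<in> A} (\<delta> x)" if "x \<in> X" for x
  proof -
    have "is_glb {v. \<exists>a\<in>fsp n. a \<in> A \<and> v = sdist n x a} (\<delta> x)"
      unfolding \<delta>_def
    proof (rule is_glb_inf[OF R\<delta>])
      show "\<exists>a\<in>fsp n. a \<in> A \<and> sdist n x a0 = sdist n x a"
        using a0 sub by blast
    qed (use that sub in \<open>auto intro!: sdist_nonneg\<close>)
    moreover have "{v. \<exists>a\<in>fsp n. a \<in> A \<and> v = sdist n x a} = {sdist n x a | a. a \<in> A}"
      using sub by blast
    ultimately show ?thesis by simp
  qed
  \<comment> \<open>Closedness of \<open>A\<close> in \<open>X\<close> provides a box around
    \<open>x\<close> that misses \<open>A\<close>; its radius is a lower bound for the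
    distances.\<close>
  have pos: "0 < \<delta> x" if x: "x \<in> X - A" for x
  proof -
    obtain e where e: "0 < e" "box n x e \<inter> A = {}" using closed x unfolding closed_inF_def by blast
    have "e \<le> sdist n x a" if "a \<in> A" for a
      using e that sub(1) by (force simp: box_iff not_less[symmetric])
    then have "e \<le> \<delta> x" using x by (intro is_glb_greatest[OF glb_\<delta>]) auto
    with e(1) show ?thesis by simp
  qed
  let ?\<Psi> = "\<lambda>x. if x \<in> A then \<psi> x else J x / \<delta> x"
  have "dft n ?\<Psi>"
    unfolding J_def \<delta>_def
    by (rule dft_if dft_divide dfp_D A \<psi>(1) dft_infF RJ R\<delta>)+
  moreover have "scont n X ?\<Psi>"
    unfolding scont_def
  proof (intro ballI allI impI)
    fix x and e :: 'a assume "x \<in> X" "0 < e"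
    then show "\<exists>r>0. \<forall>y\<in>X. sdist n x y < r \<longrightarrow> \<bar>?\<Psi> y - ?\<Psi> x\<bar> < e"
      by (intro hausdorff_formula_continuous sdist_commute sdist_triangle sdist_nonneg ge1 glb_J glb_\<delta> pos)
         (use \<psi>(2) in \<open>auto simp: scont_def\<close>)
  qed
  ultimately show ?thesis by (intro exI[of _ ?\<Psi>]) auto
qed

lemma tietze_extension:
  assumes A: "A \<in> D n" and X: "X \<in> D n" and closed: "closed_inF n A X"
    and \<phi>: "dft n \<phi>" "scont n A \<phi>"
  shows "\<exists>\<Phi>. dft n \<Phi> \<and> scont n X \<Phi> \<and> (\<forall>a\<in>A. \<Phi> a = \<phi> a)"
proof -
  have "scont n A (\<lambda>x. - \<phi> x)"
    using \<phi>(2) unfolding scont_def by (simp add: abs_minus_commute)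
  then have cont: "scont n A (\<lambda>x. max (\<phi> x) 0 + 1)" "scont n A (\<lambda>x. max (- \<phi> x) 0 + 1)"
    using scont_pos_part \<phi>(2) by blast+
  have def: "dft n (\<lambda>x. max (\<phi> x) 0 + 1)" "dft n (\<lambda>x. max (- \<phi> x) 0 + 1)"
    by (intro dft_add dft_max dft_uminus dft_const \<phi>(1))+
  obtain P where P: "dft n P" "scont n X P" "\<forall>a\<in>A. P a = max (\<phi> a) 0 + 1"
    using hausdorff_extension[OF A X closed def(1) cont(1)] by auto
  obtain N where N: "dft n N" "scont n X N" "\<forall>a\<in>A. N a = max (- \<phi> a) 0 + 1"
    using hausdorff_extension[OF A X closed def(2) cont(2)] by auto
  \<comment> \<open>The shifts by 1, which made \<open>hausdorff_extension\<close> applicable to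
    both parts, cancel.\<close>
  have "\<forall>a\<in>A. P a - N a = \<phi> a" using P(3) N(3) by (auto simp: max_def)
  then show ?thesis
    using dft_diff[OF P(1) N(1)] scont_diff[OF P(2) N(2)] by (intro exI[of _ "\<lambda>x. P x - N x"]) auto
qed

end

text \<open>Right multiplication by \<open>h\<close> maps \<open>G\<close> onto itself, because g is
  the product of g h^-1 and h. Hence an infimum over the orbit is the same at \<open>x\<close> and
  at \<open>act h x\<close>.\<close>

lemma def_G_set_transitive:
  assumes "def_top_group D m G mult ginv" "def_G_set D m G mult n X act" "h \<in> G" "x \<in> X"
  shows "(\<lambda>g. act g (act h x)) ` G = (\<lambda>g. act g x) ` G"
proof -
  obtain e where e: "e \<in> G" "\<forall>g\<in>G. mult e g = g \<and> mult g e = g"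
    "\<forall>g\<in>G. ginv g \<in> G \<and> mult (ginv g) g = e \<and> mult g (ginv g) = e"
    using assms(1) unfolding def_top_group_def by blast
  have closed: "mult g k \<in> G" if "g \<in> G" "k \<in> G" for g k
    using assms(1) that unfolding def_top_group_def by blast
  have assoc: "mult (mult g k) l = mult g (mult k l)" if "g \<in> G" "k \<in> G" "l \<in> G" for g k l
    using assms(1) that unfolding def_top_group_def by blast
  have comp: "act g (act h x) = act (mult g h) x" if "g \<in> G" for g
    using assms(2-4) that unfolding def_G_set_def by simp
  have "act g x \<in> (\<lambda>g. act g (act h x)) ` G" if g: "g \<in> G" for g
  proof
    show "mult g (ginv h) \<in> G" using closed g e(3) assms(3) by blast
    have "mult (mult g (ginv h)) h = g" using assoc[of g "ginv h" h] e g assms(3) by simp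
    then show "act g x = act (mult g (ginv h)) (act h x)"
      using comp[OF \<open>mult g (ginv h) \<in> G\<close>] by simp
  qed
  then show ?thesis using comp closed assms(3) by auto
qed

theorem theorem2p2:
  fixes D :: "nat \<Rightarrow> 'a::linordered_field list set set"
    and m n :: nat
    and G X A :: "'a list set"
    and mult :: "'a list \<Rightarrow> 'a list \<Rightarrow> 'a list"
    and ginv :: "'a list \<Rightarrow> 'a list"
    and act :: "'a list \<Rightarrow> 'a list \<Rightarrow> 'a list"
    and \<phi> :: "'a list \<Rightarrow> 'a"
  assumes "expansion_structure D"
    and "definably_complete D"
    and "G \<subseteq> fsp m"
    and "def_top_group D m G mult ginv"
    and "definably_compact D m G"
    and "X \<subseteq> fsp n"
    and "def_G_set D m G mult n X act"
    and "locally_closedF n X"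
    and "A \<in> D n"
    and "A \<subseteq> X"
    and "G_invariant_set G act A"
    and "closed_inF n A X"
    and "G_invariant_fun G act A \<phi>"
    and "def_fun D n 1 A (\<lambda>x. [\<phi> x])"
    and "contF n 1 A (\<lambda>x. [\<phi> x])"
  shows "\<exists>\<Phi> :: 'a list \<Rightarrow> 'a.
           G_invariant_fun G act X \<Phi> \<and>
           def_fun D n 1 X (\<lambda>x. [\<Phi> x]) \<and>
           contF n 1 X (\<lambda>x. [\<Phi> x]) \<and>
           (\<forall>x\<in>A. \<Phi> x = \<phi> x)"
proof -
  interpret complete_expansion D
    using assms(1,2) by unfold_locales
  have G: "G \<in> D m" "G \<noteq> {}"
    using assms(4) unfolding def_top_group_def by auto
  have X: "X \<in> D n" using assms(7) by (simp add: def_G_set_def)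
  have act_X: "act g x \<in> X" if "g \<in> G" "x \<in> X" for g x
    using assms(7) that by (simp add: def_G_set_def)
  define GX where "GX = {g @ x | g x. g \<in> G \<and> x \<in> X}"
  have GX_iff: "z \<in> GX \<longleftrightarrow> length z = m + n \<and> take m z \<in> G \<and> drop m z \<in> X" for z
  proof
    assume "length z = m + n \<and> take m z \<in> G \<and> drop m z \<in> X"
    then show "z \<in> GX" unfolding GX_def by (intro CollectI exI[of _ "take m z"] exI[of _ "drop m z"]) simp
  qed (use assms(3,6) in \<open>auto simp: GX_def subset_iff\<close>)
  have "dfp (m + n) (\<lambda>z. take m z \<in> G \<and> drop m z \<in> X)"
    by (rule dfp_conj dfp_subst[OF _ dfp_D[OF G(1)]] dfp_subst[OF _ dfp_D[OF X]] dfn_intros | simp)+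
  moreover have "{z \<in> fsp (m + n). take m z \<in> G \<and> drop m z \<in> X} = GX"
    using GX_iff by auto
  ultimately have GX: "GX \<in> D (m + n)" by (simp only: dfp_def)
  let ?act = "\<lambda>z. act (take m z) (drop m z)"
  \<comment> \<open>The action, continued by the zero vector off \<open>GX\<close>, so that its
    composite with a definable function is definable in all m + n variables.\<close>
  define total where "total z = map (\<lambda>i. if z \<in> GX then ?act z ! i else 0) [0..<n]" for z
  have total_eq: "total (g @ x) = act g x" if "g \<in> G" "x \<in> X" for g x
  proof -
    have "length g = m" "length (act g x) = n" using that assms(3,6) act_X[OF that] by auto
    moreover have "g @ x \<in> GX" using that by (auto simp: GX_def)
    ultimately show ?thesis by (simp add: total_def list_eq_iff_nth_eq)
  qed
  have "dft (m + n) (\<lambda>z. if z \<in> GX then ?act z ! i else 0)" if "i < n" for i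
    using assms(6,7) that act_X GX_iff
    by (intro dft_total[OF _ GX]) (auto simp: def_G_set_def GX_def[symmetric] subset_iff)
  then have total: "dfv (m + n) n total" by (simp add: dfv_def total_def)

  \<comment> \<open>Outside \<open>A\<close> nothing is known about \<open>\<phi>\<close>; cutting
    it off to 0 gives the total definable function that \<open>tietze_extension\<close>
    takes.\<close>
  have "dft n (\<lambda>x. if x \<in> A then [\<phi> x] ! 0 else 0)"
    using assms(9,14) by (intro dft_total) auto
  then have "dft n (\<lambda>x. if x \<in> A then \<phi> x else 0)" by (simp cong: if_cong)
  moreover have "scont n A (\<lambda>x. if x \<in> A then \<phi> x else 0)"
    using assms(6,10,15) contF_scont[of A n \<phi>] by (simp add: scont_def)
  ultimately have "\<exists>\<Phi>. dft n \<Phi> \<and> scont n X \<Phi> \<and> (\<forall>a\<in>A. \<Phi> a = (if a \<in> A then \<phi> a else 0))"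
    by (rule tietze_extension[OF assms(9) X assms(12)])
  then obtain \<Phi>0 where \<Phi>0: "dft n \<Phi>0" "scont n X \<Phi>0" "\<And>a. a \<in> A \<Longrightarrow> \<Phi>0 a = \<phi> a"
    by auto
  define F where "F z = \<Phi>0 (total z)" for z
  define \<Phi> where "\<Phi> x = infF {v. \<exists>g\<in>fsp m. g \<in> G \<and> v = F (g @ x)}" for x
  have \<Phi>_eq: "\<Phi> x = infF (\<Phi>0 ` (\<lambda>g. act g x) ` G)" if "x \<in> X" for x
  proof -
    have "{v. \<exists>g\<in>fsp m. g \<in> G \<and> v = F (g @ x)} = \<Phi>0 ` (\<lambda>g. act g x) ` G"
      using assms(3) total_eq that by (force simp: F_def)
    then show ?thesis by (simp add: \<Phi>_def)
  qed
  have F: "dft (m + n) F" unfolding F_def by (rule dft_subst[OF total \<Phi>0(1)])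
  \<comment> \<open>Continuity of \<open>\<Phi>0\<close> at \<open>act g x\<close> is combined with
    joint continuity of the action at (g, x); a box around \<open>g @ x\<close> is the product of
    boxes of the same radius around \<open>g\<close> and \<open>x\<close>.\<close>
  have cont: "\<exists>r>0. \<forall>h\<in>G. \<forall>y\<in>X. sdist m g h < r \<longrightarrow> sdist n x y < r \<longrightarrow> \<bar>F (h @ y) - F (g @ x)\<bar> < e"
    if g: "g \<in> G" and x: "x \<in> X" and e: "0 < e" for g x e
  proof -
    obtain s where s: "0 < s" "\<And>y. y \<in> X \<Longrightarrow> sdist n (act g x) y < s \<Longrightarrow> \<bar>\<Phi>0 y - \<Phi>0 (act g x)\<bar> < e"
      using \<Phi>0(2) act_X[OF g x] e unfolding scont_def by blast
    have len: "length k = m" "length y = n" if "k \<in> G" "y \<in> X" for k y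
      using that assms(3,6) by auto
    have "contF (m + n) n GX ?act" using assms(7) by (simp add: def_G_set_def GX_def)
    moreover have "g @ x \<in> GX" using g x by (auto simp: GX_def)
    ultimately obtain r where r: "0 < r" "\<And>z. z \<in> GX \<Longrightarrow> z \<in> box (m + n) (g @ x) r \<Longrightarrow> ?act z \<in> box n (act g x) s"
      using s(1) len[OF g x] unfolding contF_def by fastforce
    have "\<bar>F (h @ y) - F (g @ x)\<bar> < e"
      if hy: "h \<in> G" "y \<in> X" "sdist m g h < r" "sdist n x y < r" for h y
    proof -
      have "h @ y \<in> GX" using hy by (auto simp: GX_def)
      moreover have "h @ y \<in> box (m + n) (g @ x) r"
        using hy(3,4) r(1) len[OF g x] len[OF hy(1,2)]
        by (auto simp: box_def nth_append sdist_less_iff abs_minus_commute)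
      ultimately have "act h y \<in> box n (act g x) s" using r(2)[of "h @ y"] len[OF hy(1,2)] by simp
      then show ?thesis
        using s act_X[OF hy(1,2)] total_eq[OF g x] total_eq[OF hy(1,2)] by (simp add: F_def box_iff)
    qed
    then show ?thesis using r(1) by blast
  qed
  have \<Phi>: "dft n \<Phi>" "scont n X \<Phi>"
    using inf_over_definably_compact[OF assms(5) G(2) X F cont] unfolding \<Phi>_def by auto
  have "G_invariant_fun G act X \<Phi>"
    unfolding G_invariant_fun_def
    using \<Phi>_eq act_X def_G_set_transitive[OF assms(4,7)] by simp
  moreover have "def_fun D n 1 X (\<lambda>x. [\<Phi> x])" using def_fun_dft[OF \<Phi>(1) X] .
  moreover have "contF n 1 X (\<lambda>x. [\<Phi> x])" using contF_scont[OF assms(6)] \<Phi>(2) by blast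
  moreover have "\<Phi> a = \<phi> a" if a: "a \<in> A" for a
  proof -
    \<comment> \<open>The orbit of \<open>a\<close> stays in \<open>A\<close>, where
      \<open>\<Phi>0\<close> is the invariant \<open>\<phi>\<close>. The infimum is therefore taken
      over a single value, \<open>G\<close> being nonempty.\<close>
    have "\<Phi>0 (act g a) = \<phi> a" if "g \<in> G" for g
      using assms(11,13) \<Phi>0(3) a that by (simp add: G_invariant_set_def G_invariant_fun_def)
    then have "\<Phi>0 ` (\<lambda>g. act g a) ` G = {\<phi> a}" using G(2) by (auto simp: image_image)
    moreover have "is_glb {\<phi> a} (\<phi> a)" by (simp add: is_glb_def)
    ultimately show ?thesis using \<Phi>_eq a assms(10) is_glb_infF by (metis subsetD)
  qed
  ultimately show ?thesis by blast
qed

end
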